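(* Assume that $g$ is $\gamma$-strongly convex for some $\gamma>0$, and that $L_f>0$ and $L=\|K\|>0$. Let $\tau_0=1/(2L_f)$, $\sigma_0=L_f/L^2$ and, for $n\ge0$, $$\theta_{n+1}=1/\sqrt{1+\gamma\tau_n},\qquad\tau_{n+1}=\theta_{n+1}\tau_n,\qquad\sigma_{n+1}=\sigma_n/\theta_{n+1}.$$ Let $i\in\{1,2,3\}$ and let $(x^n,y^n)_{n\ge0}$ be generated from $(x^0,y^0)\in\mathcal X\times\mathcal Y$, with $x^{-1}=x^0$ (so that the value of $\theta_0$ is irrelevant), by $$y^{n+1}\approx_2^{\delta_{n+1}}\mathrm{prox}_{\sigma_nh^*}\big(y^n+\sigma_nK(x^n+\theta_n(x^n-x^{n-1}))\big),\qquad x^{n+1}\approx_i^{\varepsilon_{n+1}}\mathrm{prox}_{\tau_ng}\big(x^n-\tau_n(K^*y^{n+1}+\nabla f(x^n)+e^{n+1})\big),$$ for all $n\ge0$, where $\varepsilon_n,\delta_n\ge0$ and $e^n\in\mathcal X$ $(n\ge1)$ are given errors. For $N\ge1$ put $$T_N:=\sum_{n=1}^N\frac{\sigma_{n-1}}{\sigma_0},\qquad X^N:=\frac1{T_N}\sum_{n=1}^N\frac{\sigma_{n-1}}{\sigma_0}x^n,\qquad Y^N:=\frac1{T_N}\sum_{n=1}^N\frac{\sigma_{n-1}}{\sigma_0}y^n.$$ Let $\alpha>0$ and assume $$\|e^n\|=O(n^{-\alpha}),\qquad\delta_n=O(n^{-2\alpha}),\qquad\varepsilon_n=\begin{cases}O(n^{-(1+2\alpha)})&\text{if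 }i\in\{1,3\},\\O(n^{-2\alpha})&\text{if }i=2.\end{cases}$$ Then for every saddle point $(x^\star,y^\star)$ of $\mathcal L$, as $N\to\infty$, $$\mathcal L(X^N,y^\star)-\mathcal L(x^\star,Y^N)=\begin{cases}O(N^{-2})&\text{if }\alpha>1,\\O(\ln^2(N)/N^2)&\text{if }\alpha=1,\\O(N^{-2\alpha})&\text{if }\alpha\in(0,1).\end{cases}$$
   Context: $\mathcal X,\mathcal Y$ are real Hilbert spaces and $\bar{\mathbb R}=\mathbb R\cup\{+\infty\}$. $K:\mathcal X\to\mathcal Y$ is a bounded linear operator; $f:\mathcal X\to\bar{\mathbb R}$ is proper, convex, lower semicontinuous and differentiable with $\|\nabla f(x)-\nabla f(x')\|\le L_f\|x-x'\|$ for all $x,x'\in\mathrm{dom} f$; $g:\mathcal X\to\bar{\mathbb R}$ and $h:\mathcal Y\to\bar{\mathbb R}$ are proper, convex, lower semicontinuous; $h^*$ is the convex conjugate of $h$. Put $$\mathcal L(x,y)=\langle Kx,y\rangle+f(x)+g(x)-h^*(y).$$ A saddle point is a pair $(x^\star,y^\star)$ with $\mathcal L(x^\star,y)\le\mathcal L(x^\star,y^\star)\le\mathcal L(x,y^\star)$ for all $(x,y)\in\mathcal X\times\mathcal Y$; at least one is assumed to exist. $g$ is $\gamma$-strongly convex if for every $x\in\mathrm{dom}\,\partial g$, $g(x')\ge g(x)+\langle p,x'-x\rangle+\frac\gamma2\|x'-x\|^2$ for all $p\in\partial g(x)$ and all $x'\in\mathcal X$. Inexact proximal points. For a proper, convex,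 lower semicontinuous $\varphi:\mathcal H\to\bar{\mathbb R}$ on a Hilbert space $\mathcal H$, $\lambda>0$ and $v\in\mathcal H$, let $\mathrm{prox}_{\lambda\varphi}(v)=\arg\min_{u}\{\frac1{2\lambda}\|u-v\|^2+\varphi(u)\}$ and $\Phi_\lambda(u)=\frac1{2\lambda}\|u-v\|^2+\varphi(u)$. For $\varepsilon\ge0$, $\partial_\varepsilon\varphi(z)=\{p:\varphi(u)\ge\varphi(z)+\langle p,u-z\rangle-\varepsilon\ \forall u\}$. Then - $z\approx_1^{\varepsilon}\mathrm{prox}_{\lambda\varphi}(v)$ means $0\in\partial_\varepsilon\Phi_\lambda(z)$; - $z\approx_2^{\varepsilon}\mathrm{prox}_{\lambda\varphi}(v)$ means $(v-z)/\lambda\in\partial_\varepsilon\varphi(z)$; - $z\approx_3^{\varepsilon}\mathrm{prox}_{\lambda\varphi}(v)$ means there is $r\in\mathcal H$ with $\|r\|\le\sqrt{2\lambda\varepsilon}$ and $z=\mathrm{prox}_{\lambda\varphi}(v+r)$. *)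

theory Defs
  imports "HOL-Analysis.Analysis" "HOL-Library.Landau_Symbols"
begin

text \<open>
  Functions with values in \<open>\<real> \<union> {+\<infinity>}\<close> are rendered as \<open>ereal\<close>-valued functions; the value
  \<open>-\<infinity>\<close> is excluded by \<open>proper\<close>.
\<close>

definition edom :: "('a \<Rightarrow> ereal) \<Rightarrow> 'a set" where
  "edom \<phi> = {x. \<phi> x < \<infinity>}"

definition proper :: "('a \<Rightarrow> ereal) \<Rightarrow> bool" where
  "proper \<phi> \<longleftrightarrow> (\<forall>x. \<phi> x \<noteq> -\<infinity>) \<and> edom \<phi> \<noteq> {}"

text \<open>The boundary cases \<open>t = 0\<close> and \<open>t = 1\<close> are harmless since \<open>0 * \<infinity> = 0\<close> in \<open>ereal\<close>.\<close>

definition econvex :: "('a::real_vector \<Rightarrow> ereal) \<Rightarrow> bool" where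
  "econvex \<phi> \<longleftrightarrow> (\<forall>x y. \<forall>t\<in>{0..1}.
     \<phi> ((1 - t) *\<^sub>R x + t *\<^sub>R y) \<le> ereal (1 - t) * \<phi> x + ereal t * \<phi> y)"

definition lower_semicont :: "('a::topological_space \<Rightarrow> ereal) \<Rightarrow> bool" where
  "lower_semicont \<phi> \<longleftrightarrow> (\<forall>x. \<phi> x \<le> Liminf (at x) \<phi>)"

definition proper_convex_lsc :: "('a::real_normed_vector \<Rightarrow> ereal) \<Rightarrow> bool" where
  "proper_convex_lsc \<phi> \<longleftrightarrow> proper \<phi> \<and> econvex \<phi> \<and> lower_semicont \<phi>"

text \<open>
  Frechet gradient of an extended-valued function. Membership in the interior of the domain is
  required because \<open>real_of_ereal\<close> sends \<open>\<infinity>\<close> to \<open>0\<close>: near such a point the real-valued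
  function agrees with the extended-valued one.
\<close>

definition has_egradient :: "('a::real_inner \<Rightarrow> ereal) \<Rightarrow> 'a \<Rightarrow> 'a \<Rightarrow> bool" where
  "has_egradient \<phi> x d \<longleftrightarrow>
     x \<in> interior (edom \<phi>) \<and> GDERIV (\<lambda>u. real_of_ereal (\<phi> u)) x :> d"

definition egradient :: "('a::real_inner \<Rightarrow> ereal) \<Rightarrow> 'a \<Rightarrow> 'a" where
  "egradient \<phi> x = (THE d. has_egradient \<phi> x d)"

definition differentiable_on_edom :: "('a::real_inner \<Rightarrow> ereal) \<Rightarrow> bool" where
  "differentiable_on_edom \<phi> \<longleftrightarrow> (\<forall>x\<in>edom \<phi>. \<exists>d. has_egradient \<phi> x d)"

definition conjugate :: "('a::real_inner \<Rightarrow> ereal) \<Rightarrow> 'a \<Rightarrow> ereal" where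
  "conjugate \<phi> y = (SUP z. ereal (y \<bullet> z) - \<phi> z)"

definition eps_subdiff :: "real \<Rightarrow> ('a::real_inner \<Rightarrow> ereal) \<Rightarrow> 'a \<Rightarrow> 'a set" where
  "eps_subdiff \<epsilon> \<phi> z = {p. \<forall>u. \<phi> u \<ge> \<phi> z + ereal (p \<bullet> (u - z)) - ereal \<epsilon>}"

definition subdiff :: "('a::real_inner \<Rightarrow> ereal) \<Rightarrow> 'a \<Rightarrow> 'a set" where
  "subdiff \<phi> z = {p. \<forall>u. \<phi> u \<ge> \<phi> z + ereal (p \<bullet> (u - z))}"

definition strongly_convex :: "real \<Rightarrow> ('a::real_inner \<Rightarrow> ereal) \<Rightarrow> bool" where
  "strongly_convex \<gamma> \<phi> \<longleftrightarrow> (\<forall>x. subdiff \<phi> x \<noteq> {} \<longrightarrow> (\<forall>p\<in>subdiff \<phi> x. \<forall>x'.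
     \<phi> x' \<ge> \<phi> x + ereal (p \<bullet> (x' - x)) + ereal (\<gamma> / 2 * (norm (x' - x))\<^sup>2)))"

definition prox_objective ::
    "real \<Rightarrow> ('a::real_inner \<Rightarrow> ereal) \<Rightarrow> 'a \<Rightarrow> 'a \<Rightarrow> ereal" where
  "prox_objective \<mu> \<phi> v u = ereal (1 / (2 * \<mu>) * (norm (u - v))\<^sup>2) + \<phi> u"

definition is_prox :: "real \<Rightarrow> ('a::real_inner \<Rightarrow> ereal) \<Rightarrow> 'a \<Rightarrow> 'a \<Rightarrow> bool" where
  "is_prox \<mu> \<phi> v z \<longleftrightarrow> is_arg_min (prox_objective \<mu> \<phi> v) (\<lambda>_. True) z"

definition approx_prox1 ::
    "real \<Rightarrow> real \<Rightarrow> ('a::real_inner \<Rightarrow> ereal) \<Rightarrow> 'a \<Rightarrow> 'a \<Rightarrow> bool" where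
  "approx_prox1 \<epsilon> \<mu> \<phi> v z \<longleftrightarrow> 0 \<in> eps_subdiff \<epsilon> (prox_objective \<mu> \<phi> v) z"

definition approx_prox2 ::
    "real \<Rightarrow> real \<Rightarrow> ('a::real_inner \<Rightarrow> ereal) \<Rightarrow> 'a \<Rightarrow> 'a \<Rightarrow> bool" where
  "approx_prox2 \<epsilon> \<mu> \<phi> v z \<longleftrightarrow> (1 / \<mu>) *\<^sub>R (v - z) \<in> eps_subdiff \<epsilon> \<phi> z"

definition approx_prox3 ::
    "real \<Rightarrow> real \<Rightarrow> ('a::real_inner \<Rightarrow> ereal) \<Rightarrow> 'a \<Rightarrow> 'a \<Rightarrow> bool" where
  "approx_prox3 \<epsilon> \<mu> \<phi> v z \<longleftrightarrow> (\<exists>r. norm r \<le> sqrt (2 * \<mu> * \<epsilon>) \<and> is_prox \<mu> \<phi> (v + r) z)"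

definition approx_prox ::
    "nat \<Rightarrow> real \<Rightarrow> real \<Rightarrow> ('a::real_inner \<Rightarrow> ereal) \<Rightarrow> 'a \<Rightarrow> 'a \<Rightarrow> bool" where
  "approx_prox i \<epsilon> \<mu> \<phi> v z \<longleftrightarrow>
     (i = 1 \<and> approx_prox1 \<epsilon> \<mu> \<phi> v z) \<or>
     (i = 2 \<and> approx_prox2 \<epsilon> \<mu> \<phi> v z) \<or>
     (i = 3 \<and> approx_prox3 \<epsilon> \<mu> \<phi> v z)"

text \<open>
  In \<open>ereal\<close>, \<open>\<infinity> - \<infinity> = \<infinity>\<close>, so the Lagrangian is \<open>\<infinity>\<close> as soon as \<open>f x + g x = \<infinity>\<close>.
  For \<open>h\<close> proper and \<open>edom f \<inter> edom g\<close> nonempty this choice does not affect which points are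
  saddle points: at a saddle point all terms are finite.
\<close>

definition lagrangian ::
    "('a::real_inner \<Rightarrow> 'b::real_inner) \<Rightarrow> ('a \<Rightarrow> ereal) \<Rightarrow> ('a \<Rightarrow> ereal) \<Rightarrow> ('b \<Rightarrow> ereal)
     \<Rightarrow> 'a \<Rightarrow> 'b \<Rightarrow> ereal" where
  "lagrangian K f g h x y = ereal (K x \<bullet> y) + f x + g x - conjugate h y"

definition saddle_point :: "('a \<Rightarrow> 'b \<Rightarrow> ereal) \<Rightarrow> 'a \<Rightarrow> 'b \<Rightarrow> bool" where
  "saddle_point \<L> xs ys \<longleftrightarrow> (\<forall>x y. \<L> xs y \<le> \<L> xs ys \<and> \<L> xs ys \<le> \<L> x ys)"

text \<open>
  Truncated subtraction gives \<open>x (0 - 1) = x 0\<close>, which is the convention that the iterate with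
  index \<open>-1\<close> equals the initial one.
\<close>

definition extrapolation :: "(nat \<Rightarrow> real) \<Rightarrow> (nat \<Rightarrow> 'a::real_vector) \<Rightarrow> nat \<Rightarrow> 'a" where
  "extrapolation \<theta> x n = x n + \<theta> n *\<^sub>R (x n - x (n - 1))"

definition weight_sum :: "(nat \<Rightarrow> real) \<Rightarrow> nat \<Rightarrow> real" where
  "weight_sum \<sigma> N = (\<Sum>n=1..N. \<sigma> (n - 1) / \<sigma> 0)"

definition ergodic_mean :: "(nat \<Rightarrow> real) \<Rightarrow> (nat \<Rightarrow> 'a::real_vector) \<Rightarrow> nat \<Rightarrow> 'a" where
  "ergodic_mean \<sigma> z N = (1 / weight_sum \<sigma> N) *\<^sub>R (\<Sum>n=1..N. (\<sigma> (n - 1) / \<sigma> 0) *\<^sub>R z n)"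

text \<open>
  An extended-valued sequence is \<open>O(b)\<close> if it is eventually finite and its real values are
  \<open>O(b)\<close>; without the first condition infinite values would be counted as \<open>0\<close>.
\<close>

definition ereal_bigo :: "(nat \<Rightarrow> ereal) \<Rightarrow> (nat \<Rightarrow> real) \<Rightarrow> bool" where
  "ereal_bigo a b \<longleftrightarrow>
     (\<forall>\<^sub>F n in sequentially. \<bar>a n\<bar> \<noteq> \<infinity>) \<and> (\<lambda>n. real_of_ereal (a n)) \<in> O(b)"

end

theory Submission
  imports Defs
begin

text \<open>
  One step of the method, tested at the saddle point and multiplied by \<open>\<sigma> n\<close>, makes the energy
  \<open>\<sigma> n / \<tau> n / 2 * (norm (xs - x n))\<^sup>2 + 1 / 2 * (norm (ys - y n))\<^sup>2\<close> (corrected by the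
  coupling term) decrease by \<open>\<sigma> n\<close> times the primal-dual gap, up to an error of the form
  \<open>\<sigma> n * (E * norm (xs - x (Suc n)) + A)\<close> with \<open>E = O(n powr - \<alpha>)\<close> and \<open>A = O(n powr (- 2 * \<alpha>))\<close>.
  All three notions of inexactness fit this form: \<open>\<epsilon>\<close> enters \<open>E\<close> through \<open>sqrt (\<epsilon> * m)\<close>, where
  \<open>m\<close> is \<open>\<gamma>\<close> for type 2 and \<open>\<gamma> + 1 / \<tau>\<close>, which grows linearly, for types 1 and 3. Since
  \<open>\<sigma> n\<close> and \<open>1 / \<tau> n\<close> grow linearly, \<open>n * norm (xs - x n)\<close> and the square root of the weighted
  sum of gaps are \<open>O(P n)\<close> for \<open>P n = (\<Sum>k=1..n. real k powr - \<alpha>)\<close>, and convexity of the gap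
  bounds its value at the ergodic means by a multiple of \<open>(P N)\<^sup>2 / N\<^sup>2\<close>.
\<close>

section \<open>Convex functions and proximal points in Hilbert space\<close>

lemma proper_ereal:
  assumes "proper \<phi>" "x \<in> edom \<phi>"
  shows "\<phi> x = ereal (real_of_ereal (\<phi> x))"
  using assms by (cases "\<phi> x") (auto simp: proper_def edom_def)

lemma proper_convex_lscD:
  assumes "proper_convex_lsc \<phi>"
  shows "proper \<phi>" "econvex \<phi>" "lower_semicont \<phi>"
  using assms by (auto simp: proper_convex_lsc_def)

lemma econvexD:
  assumes "proper \<phi>" "econvex \<phi>" "x \<in> edom \<phi>" "y \<in> edom \<phi>" "0 \<le> t" "t \<le> 1"
  shows "\<phi> ((1 - t) *\<^sub>R x + t *\<^sub>R y)
    \<le> ereal ((1 - t) * real_of_ereal (\<phi> x) + t * real_of_ereal (\<phi> y))"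
proof -
  have "\<phi> ((1 - t) *\<^sub>R x + t *\<^sub>R y) \<le> ereal (1 - t) * \<phi> x + ereal t * \<phi> y"
    using assms by (auto simp: econvex_def)
  then show ?thesis
    using proper_ereal[OF assms(1,3)] proper_ereal[OF assms(1,4)]
    by (metis plus_ereal.simps(1) times_ereal.simps(1))
qed

lemma convex_on_edom:
  assumes "proper \<phi>" "econvex \<phi>"
  shows "convex_on (edom \<phi>) (\<lambda>u. real_of_ereal (\<phi> u))"
proof -
  have *: "(1 - t) *\<^sub>R x + t *\<^sub>R y \<in> edom \<phi>"
      "real_of_ereal (\<phi> ((1 - t) *\<^sub>R x + t *\<^sub>R y))
        \<le> (1 - t) * real_of_ereal (\<phi> x) + t * real_of_ereal (\<phi> y)"
    if "x \<in> edom \<phi>" "y \<in> edom \<phi>" "0 \<le> t" "t \<le> 1" for x y t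
  proof -
    note le = econvexD[OF assms that]
    then show dom: "(1 - t) *\<^sub>R x + t *\<^sub>R y \<in> edom \<phi>"
      by (auto simp: edom_def intro: le_less_trans)
    show "real_of_ereal (\<phi> ((1 - t) *\<^sub>R x + t *\<^sub>R y))
        \<le> (1 - t) * real_of_ereal (\<phi> x) + t * real_of_ereal (\<phi> y)"
      using le proper_ereal[OF assms(1) dom] by (metis ereal_less_eq(3))
  qed
  show ?thesis
    by (rule convex_onI) (use * in \<open>auto simp: convex_alt\<close>)
qed

text \<open>The definition speaks of the punctured filter \<open>at z\<close>; the hypothesis at
  \<open>z\<close> itself completes it to a full neighbourhood.\<close>

lemma lower_semicont_eventually:
  assumes "lower_semicont \<phi>" "c < \<phi> z"
  shows "\<forall>\<^sub>F u in nhds z. c < \<phi> u"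
proof -
  have "\<phi> z \<le> Liminf (at z) \<phi>"
    using assms by (auto simp: lower_semicont_def)
  then show ?thesis
    using assms(2) by (auto simp: le_Liminf_iff eventually_nhds_conv_at)
qed

text \<open>Phrased with upper bounds \<open>c k\<close> so that it serves both limits of minimising
  sequences and the closedness of a domain.\<close>

lemma lower_semicont_sequentially:
  assumes "lower_semicont \<phi>" "X \<longlonglongrightarrow> z" "\<And>k. \<phi> (X k) \<le> ereal (c k)" "c \<longlonglongrightarrow> l"
  shows "\<phi> z \<le> ereal l"
proof (rule ccontr)
  assume "\<not> \<phi> z \<le> ereal l"
  then have "ereal l < \<phi> z"
    by simp
  then obtain d where d: "ereal l < ereal d" "ereal d < \<phi> z"
    using ereal_dense2 by blast
  have "\<forall>\<^sub>F k in sequentially. ereal d < \<phi> (X k)"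
    using lower_semicont_eventually[OF assms(1) d(2)] assms(2)
    by (auto simp: filterlim_iff)
  moreover have "\<forall>\<^sub>F k in sequentially. c k < d"
    using assms(4) d(1) by (auto simp: order_tendsto_iff)
  ultimately have "\<forall>\<^sub>F k in sequentially. False"
  proof eventually_elim
    case (elim k)
    then show ?case
      using assms(3)[of k] by (metis ereal_less_eq(3) leD less_imp_le order_less_le_trans)
  qed
  then show False
    by simp
qed

text \<open>Lower semicontinuity bounds \<open>\<phi>\<close> from below near a point of its domain, and convexity
  propagates this bound with linear loss along rays; no separation theorem is needed.\<close>

lemma norm_minorant:
  fixes \<phi> :: "'a::real_normed_vector \<Rightarrow> ereal"
  assumes "proper_convex_lsc \<phi>"
  obtains b a where "b \<ge> 0" "\<And>u. ereal (a - b * norm u) \<le> \<phi> u"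
proof -
  note p = proper_convex_lscD[OF assms]
  obtain z where z: "z \<in> edom \<phi>"
    using p(1) by (auto simp: proper_def)
  define c where "c = real_of_ereal (\<phi> z)"
  have c: "\<phi> z = ereal c"
    using proper_ereal[OF p(1) z] by (simp add: c_def)
  have "\<forall>\<^sub>F u in nhds z. ereal (c - 1) < \<phi> u"
    by (rule lower_semicont_eventually[OF p(3)]) (simp add: c)
  then obtain r where r: "r > 0" "\<And>u. dist u z < r \<Longrightarrow> ereal (c - 1) < \<phi> u"
    by (auto simp: eventually_nhds_metric)
  define s where "s = r / 2"
  have s: "s > 0" "\<And>u. norm (u - z) \<le> s \<Longrightarrow> ereal (c - 1) < \<phi> u"
    using r by (auto simp: s_def dist_norm)
  have main: "ereal (c - 1 - norm (u - z) / s) \<le> \<phi> u" for u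
  proof (cases "norm (u - z) \<le> s")
    case True
    then have "ereal (c - 1) \<le> \<phi> u"
      using s(2) by (simp add: less_imp_le)
    moreover have "ereal (c - 1 - norm (u - z) / s) \<le> ereal (c - 1)"
      using s(1) by simp
    ultimately show ?thesis
      by (rule order_trans[rotated])
  next
    case False
    show ?thesis
    proof (cases "u \<in> edom \<phi>")
      case False
      then show ?thesis
        by (simp add: edom_def)
    next
      case True
      \<comment> \<open>This \<open>t\<close> places the point of the segment from \<open>z\<close>
        to \<open>u\<close> at distance exactly \<open>s\<close> from \<open>z\<close>, where the
        local bound holds.\<close>
      define t where "t = s / norm (u - z)"
      have t: "0 < t" "t \<le> 1"
        using False s(1) by (auto simp: t_def divide_simps split: if_splits)
      have "norm ((1 - t) *\<^sub>R z + t *\<^sub>R u - z) = t * norm (u - z)"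
        using t by (simp add: algebra_simps flip: scaleR_diff_right)
      also have "\<dots> = s"
        using False s(1) by (auto simp: t_def)
      finally have "ereal (c - 1) < \<phi> ((1 - t) *\<^sub>R z + t *\<^sub>R u)"
        by (intro s(2)) simp
      also have "\<dots> \<le> ereal ((1 - t) * c + t * real_of_ereal (\<phi> u))"
        unfolding c_def using t by (intro econvexD p z True) auto
      finally have "t * c - 1 < t * real_of_ereal (\<phi> u)"
        by (simp add: algebra_simps)
      then have "c - 1 / t < real_of_ereal (\<phi> u)"
        using t by (simp add: field_simps)
      then have "c - 1 - norm (u - z) / s \<le> real_of_ereal (\<phi> u)"
        by (simp add: t_def)
      then show ?thesis
        using proper_ereal[OF p(1) True] by (metis ereal_less_eq(3))
    qed
  qed
  show ?thesis
  proof (rule that[of "1 / s" "c - 1 - norm z / s"])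
    fix u
    have "norm (u - z) / s \<le> (norm u + norm z) / s"
      using s(1) by (intro divide_right_mono norm_triangle_ineq4) auto
    then have "ereal (c - 1 - norm z / s - 1 / s * norm u) \<le> ereal (c - 1 - norm (u - z) / s)"
      by (simp add: add_divide_distrib)
    then show "ereal (c - 1 - norm z / s - 1 / s * norm u) \<le> \<phi> u"
      using main order_trans by blast
  qed (use s in auto)
qed

section \<open>Existence and optimality conditions of proximal points\<close>

lemma norm_midpoint_square:
  fixes u w v :: "'a::real_inner"
  shows "(norm ((1 - 1/2) *\<^sub>R u + (1/2) *\<^sub>R w - v))\<^sup>2
    = (norm (u - v))\<^sup>2 / 2 + (norm (w - v))\<^sup>2 / 2 - (norm (u - w))\<^sup>2 / 4"
  by (simp add: power2_norm_eq_inner inner_simps inner_commute field_simps)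

text \<open>Points outside the domain have infinite objective and never compete, so the minimisation
  can be carried out with real numbers.\<close>

lemma is_prox_iff:
  assumes "proper \<phi>"
  shows "is_prox \<mu> \<phi> v z \<longleftrightarrow> z \<in> edom \<phi> \<and>
    (\<forall>u\<in>edom \<phi>. 1 / (2 * \<mu>) * (norm (z - v))\<^sup>2 + real_of_ereal (\<phi> z)
      \<le> 1 / (2 * \<mu>) * (norm (u - v))\<^sup>2 + real_of_ereal (\<phi> u))"
  (is "_ \<longleftrightarrow> _ \<and> (\<forall>u\<in>edom \<phi>. ?o z \<le> ?o u)")
proof -
  have fin: "prox_objective \<mu> \<phi> v u = ereal (?o u)" if "u \<in> edom \<phi>" for u
    using proper_ereal[OF assms that] unfolding prox_objective_def by (metis plus_ereal.simps(1))
  have inf: "prox_objective \<mu> \<phi> v u = \<infinity>" if "u \<notin> edom \<phi>" for u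
    using that by (simp add: edom_def prox_objective_def)
  obtain w where w: "w \<in> edom \<phi>"
    using assms by (auto simp: proper_def)
  show ?thesis
  proof
    assume "is_prox \<mu> \<phi> v z"
    then have le: "prox_objective \<mu> \<phi> v z \<le> prox_objective \<mu> \<phi> v u" for u
      by (auto simp: is_prox_def is_arg_min_def not_less)
    have "z \<in> edom \<phi>"
      using le[of w] inf[of z] fin[OF w] by (cases "z \<in> edom \<phi>") auto
    with le show "z \<in> edom \<phi> \<and> (\<forall>u\<in>edom \<phi>. ?o z \<le> ?o u)"
      by (metis fin ereal_less_eq(3))
  next
    assume *: "z \<in> edom \<phi> \<and> (\<forall>u\<in>edom \<phi>. ?o z \<le> ?o u)"
    have "prox_objective \<mu> \<phi> v z \<le> prox_objective \<mu> \<phi> v u" for u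
      using * by (cases "u \<in> edom \<phi>") (simp_all add: fin inf)
    then show "is_prox \<mu> \<phi> v z"
      by (auto simp: is_prox_def is_arg_min_def not_less)
  qed
qed

text \<open>The direct method: the norm minorant bounds the objective below, the parallelogram
  identity makes a minimising sequence Cauchy, and lower semicontinuity makes its limit a
  minimiser.\<close>

lemma ex_is_prox:
  fixes \<phi> :: "'a::{real_inner,complete_space} \<Rightarrow> ereal"
  assumes \<phi>: "proper_convex_lsc \<phi>" and \<mu>: "\<mu> > 0"
  obtains z where "is_prox \<mu> \<phi> v z"
proof -
  note p = proper_convex_lscD[OF \<phi>]
  define r where "r u = real_of_ereal (\<phi> u)" for u
  define obj where "obj u = 1 / (2 * \<mu>) * (norm (u - v))\<^sup>2 + r u" for u
  have r: "\<phi> u = ereal (r u)" if "u \<in> edom \<phi>" for u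
    using proper_ereal[OF p(1) that] by (simp add: r_def)
  obtain b a where ab: "b \<ge> 0" "\<And>u. ereal (a - b * norm u) \<le> \<phi> u"
    using norm_minorant[OF \<phi>] by metis
  have lower: "a - b * norm v - \<mu> * b\<^sup>2 / 2 \<le> obj u" if "u \<in> edom \<phi>" for u
  proof -
    have "a - b * norm u \<le> r u"
      using ab(2)[of u] r[OF that] by simp
    moreover have "b * norm u \<le> b * norm v + b * norm (u - v)"
      using norm_triangle_ineq[of v "u - v"] ab(1)
      by (metis add.commute diff_add_cancel distrib_left mult_left_mono)
    \<comment> \<open>Completing the square: the quadratic term dominates the linear loss up to a
      constant.\<close>
    moreover have "0 \<le> (norm (u - v) - \<mu> * b)\<^sup>2 / (2 * \<mu>)"
      using \<mu> by simp
    then have "b * norm (u - v) \<le> 1 / (2 * \<mu>) * (norm (u - v))\<^sup>2 + \<mu> * b\<^sup>2 / 2"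
      using \<mu> by (simp add: power2_eq_square field_simps)
    ultimately show ?thesis
      by (simp add: obj_def)
  qed
  define I where "I = (INF u\<in>edom \<phi>. obj u)"
  have bdd: "bdd_below (obj ` edom \<phi>)"
    using lower by (auto simp: bdd_below_def)
  have ne: "edom \<phi> \<noteq> {}"
    using p(1) by (simp add: proper_def)
  have I: "I \<le> obj u" if "u \<in> edom \<phi>" for u
    unfolding I_def using bdd that by (rule cINF_lower)
  have "\<exists>u\<in>edom \<phi>. obj u < I + inverse (real (Suc k))" for k
    using cInf_lessD[of "obj ` edom \<phi>" "I + inverse (real (Suc k))"] ne
    by (auto simp: I_def)
  then obtain X where X: "\<And>k. X k \<in> edom \<phi>" "\<And>k. obj (X k) < I + inverse (real (Suc k))"
    by metis
  have conv: "convex_on (edom \<phi>) r"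
    unfolding r_def by (rule convex_on_edom[OF p(1,2)])
  \<comment> \<open>\<open>I\<close> is compared with the objective at the midpoint, so the squared
    distance of two points is controlled by their excess over the infimum.\<close>
  have gap: "(norm (u - w))\<^sup>2 \<le> 8 * \<mu> * ((obj u - I) / 2 + (obj w - I) / 2)"
    if uw: "u \<in> edom \<phi>" "w \<in> edom \<phi>" for u w
  proof -
    let ?m = "(1 - 1/2) *\<^sub>R u + (1/2) *\<^sub>R w"
    have "?m \<in> edom \<phi>"
      using uw convex_on_imp_convex[OF conv] by (intro convexD_alt) auto
    then have "I \<le> 1 / (2 * \<mu>) * (norm (?m - v))\<^sup>2 + r ?m"
      using I by (simp only: obj_def)
    also have "r ?m \<le> (1 - 1/2) * r u + (1/2) * r w"
      using uw by (intro convex_onD[OF conv]) auto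
    finally have "I \<le> 1 / (2 * \<mu>) * (norm (?m - v))\<^sup>2 + ((1 - 1/2) * r u + (1/2) * r w)"
      by simp
    then have "I \<le> obj u / 2 + obj w / 2 - (norm (u - w))\<^sup>2 / (8 * \<mu>)"
      unfolding norm_midpoint_square obj_def by (simp add: algebra_simps add_divide_distrib diff_divide_distrib)
    then show ?thesis
      using \<mu> by (simp add: field_simps)
  qed
  have "Cauchy X"
  proof (rule metric_CauchyI)
    fix d :: real assume d: "d > 0"
    have "(\<lambda>k. inverse (real (Suc k))) \<longlonglongrightarrow> 0"
      by (rule LIMSEQ_inverse_real_of_nat)
    moreover have "0 < d\<^sup>2 / (8 * \<mu>)"
      using d \<mu> by simp
    ultimately have "\<forall>\<^sub>F k in sequentially. inverse (real (Suc k)) < d\<^sup>2 / (8 * \<mu>)"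
      by (rule order_tendstoD(2))
    then obtain M where M: "\<And>k. k \<ge> M \<Longrightarrow> inverse (real (Suc k)) < d\<^sup>2 / (8 * \<mu>)"
      by (auto simp: eventually_sequentially)
    have "dist (X m) (X n) < d" if mn: "m \<ge> M" "n \<ge> M" for m n
    proof -
      have "(obj (X m) - I) / 2 + (obj (X n) - I) / 2 < d\<^sup>2 / (8 * \<mu>)"
        using less_trans[OF X(2) add_strict_left_mono[OF M[OF mn(1)]]]
          less_trans[OF X(2) add_strict_left_mono[OF M[OF mn(2)]]]
        by (simp add: field_simps)
      then have "8 * \<mu> * ((obj (X m) - I) / 2 + (obj (X n) - I) / 2) < d\<^sup>2"
        using \<mu> by (simp add: field_simps)
      then have "(norm (X m - X n))\<^sup>2 < d\<^sup>2"
        using gap[OF X(1) X(1), of m n] by linarith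
      then show ?thesis
        using d by (simp add: dist_norm power_less_imp_less_base)
    qed
    then show "\<exists>M. \<forall>m\<ge>M. \<forall>n\<ge>M. dist (X m) (X n) < d"
      by blast
  qed
  then obtain z where z: "X \<longlonglongrightarrow> z"
    using Cauchy_convergent convergent_def by blast
  \<comment> \<open>The quadratic term is continuous, so it moves into the bounding sequence and
    lower semicontinuity is applied to \<open>\<phi>\<close> alone.\<close>
  have "\<phi> z \<le> ereal (I + 0 - 1 / (2 * \<mu>) * (norm (z - v))\<^sup>2)"
  proof (rule lower_semicont_sequentially[OF p(3) z])
    show "\<phi> (X k) \<le> ereal (I + inverse (real (Suc k)) - 1 / (2 * \<mu>) * (norm (X k - v))\<^sup>2)" for k
      using X(2)[of k] r[OF X(1)] by (simp add: obj_def)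
    show "(\<lambda>k. I + inverse (real (Suc k)) - 1 / (2 * \<mu>) * (norm (X k - v))\<^sup>2)
        \<longlonglongrightarrow> I + 0 - 1 / (2 * \<mu>) * (norm (z - v))\<^sup>2"
      by (intro tendsto_intros z LIMSEQ_inverse_real_of_nat)
  qed
  moreover from this have "z \<in> edom \<phi>"
    by (auto simp: edom_def intro: le_less_trans)
  ultimately have "z \<in> edom \<phi>" "obj z \<le> I"
    using r[of z] by (auto simp: obj_def)
  then have "is_prox \<mu> \<phi> v z"
    unfolding is_prox_iff[OF p(1)] using I unfolding obj_def r_def by (auto intro: order_trans)
  then show ?thesis
    by (rule that)
qed

lemma nonneg_if_linear_nonneg:
  fixes a b :: real
  assumes "\<And>t. 0 < t \<Longrightarrow> t \<le> 1 \<Longrightarrow> 0 \<le> a + t * b"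
  shows "0 \<le> a"
proof (rule tendsto_lowerbound)
  show "((\<lambda>t. a + t * b) \<longlongrightarrow> a) (at_right 0)"
    by (auto intro!: tendsto_eq_intros)
  show "\<forall>\<^sub>F t in at_right 0. 0 \<le> a + t * b"
    by (auto intro!: eventually_at_rightI[of 0 1] assms)
qed simp

text \<open>Minimality is tested on the segment from \<open>z\<close> towards \<open>u\<close>:
  after division by \<open>t\<close> the quadratic term is of order \<open>t\<close> and disappears
  in the limit.\<close>

lemma is_prox_subgradient:
  assumes p: "proper \<phi>" "econvex \<phi>" and \<mu>: "\<mu> > 0" and prox: "is_prox \<mu> \<phi> v z"
  shows "z \<in> edom \<phi>" "(1 / \<mu>) *\<^sub>R (v - z) \<in> subdiff \<phi> z"
proof -
  let ?r = "\<lambda>u. real_of_ereal (\<phi> u)"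
  show z: "z \<in> edom \<phi>"
    using prox by (simp add: is_prox_iff[OF p(1)])
  have main: "?r z + (1 / \<mu>) *\<^sub>R (v - z) \<bullet> (u - z) \<le> ?r u" if u: "u \<in> edom \<phi>" for u
  proof -
    have "0 \<le> (?r u - ?r z - (v - z) \<bullet> (u - z) / \<mu>) + t * ((norm (u - z))\<^sup>2 / (2 * \<mu>))"
      if t: "0 < t" "t \<le> 1" for t
    proof -
      let ?w = "(1 - t) *\<^sub>R z + t *\<^sub>R u"
      note conv = convex_on_edom[OF p]
      have "?w \<in> edom \<phi>"
        using z u t convex_on_imp_convex[OF conv] unfolding convex_alt by auto
      then have "1 / (2 * \<mu>) * (norm (z - v))\<^sup>2 + ?r z
          \<le> 1 / (2 * \<mu>) * (norm (?w - v))\<^sup>2 + ?r ?w"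
        using prox by (simp add: is_prox_iff[OF p(1)])
      also have "?r ?w \<le> (1 - t) * ?r z + t * ?r u"
        using z u t by (intro convex_onD[OF conv]) auto
      also have "(norm (?w - v))\<^sup>2
          = (norm (z - v))\<^sup>2 - 2 * t * ((v - z) \<bullet> (u - z)) + t\<^sup>2 * (norm (u - z))\<^sup>2"
        unfolding power2_norm_eq_inner
        by (simp add: inner_simps inner_commute algebra_simps power2_eq_square)
      finally have "0 \<le> t * ((?r u - ?r z - (v - z) \<bullet> (u - z) / \<mu>) + t * ((norm (u - z))\<^sup>2 / (2 * \<mu>)))"
        using \<mu> by (simp add: algebra_simps power2_eq_square add_divide_distrib diff_divide_distrib)
      then show ?thesis
        using t by (simp add: zero_le_mult_iff)
    qed
    then have "0 \<le> ?r u - ?r z - (v - z) \<bullet> (u - z) / \<mu>"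
      by (rule nonneg_if_linear_nonneg)
    then show ?thesis
      by simp
  qed
  have "\<phi> z + ereal ((1 / \<mu>) *\<^sub>R (v - z) \<bullet> (u - z)) \<le> \<phi> u" for u
  proof (cases "u \<in> edom \<phi>")
    case True
    then show ?thesis
      using main[OF True] proper_ereal[OF p(1) z] proper_ereal[OF p(1) True]
      by (metis ereal_less_eq(3) plus_ereal.simps(1))
  qed (simp add: edom_def)
  then show "(1 / \<mu>) *\<^sub>R (v - z) \<in> subdiff \<phi> z"
    by (simp add: subdiff_def)
qed

text \<open>The Riesz representation of \<open>l\<close> is read off the optimality condition of the proximal point
  of \<open>- l\<close> at \<open>0\<close>.\<close>

lemma riesz_representation:
  fixes l :: "'a::{real_inner,complete_space} \<Rightarrow> real"
  assumes "bounded_linear l"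
  obtains w where "\<And>u. l u = w \<bullet> u"
proof -
  interpret bounded_linear l by fact
  let ?\<phi> = "\<lambda>u. ereal (- l u)"
  have "isCont l u" for u
    by (rule isCont) simp
  then have "(?\<phi> \<longlongrightarrow> ?\<phi> u) (at u)" for u
    by (auto simp: isCont_def intro: tendsto_intros)
  then have "lower_semicont ?\<phi>"
    unfolding lower_semicont_def
    by (auto simp: le_Liminf_iff order_tendsto_iff)
  moreover have "proper ?\<phi>" "econvex ?\<phi>"
    by (auto simp: proper_def edom_def econvex_def add scaleR)
  ultimately have \<phi>: "proper_convex_lsc ?\<phi>"
    by (simp add: proper_convex_lsc_def)
  obtain z where z: "is_prox 1 ?\<phi> 0 z"
    using ex_is_prox[OF \<phi>] by (metis zero_less_one)
  have "(1 / 1) *\<^sub>R (0 - z) \<in> subdiff ?\<phi> z"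
    by (rule is_prox_subgradient(2)[OF proper_convex_lscD(1,2)[OF \<phi>] _ z]) simp
  then have le: "- (z \<bullet> (u - z)) - l z \<le> - l u" for u
    by (simp add: subdiff_def)
  \<comment> \<open>Testing at \<open>z + u\<close> and at \<open>z - u\<close> gives the two
    opposite inequalities.\<close>
  have "l u = z \<bullet> u" for u
    using le[of "z + u"] le[of "z - u"] by (simp add: add diff)
  then show ?thesis
    by (rule that)
qed

text \<open>\<open>adjoint\<close> is defined by choice, so its identity holds as soon as some map
  satisfies it; the Riesz representation supplies such a map pointwise.\<close>

lemma hilbert_adjoint:
  fixes K :: "'a::{real_inner,complete_space} \<Rightarrow> 'b::real_inner"
  assumes "bounded_linear K"
  shows "K u \<bullet> w = u \<bullet> adjoint K w"
proof -
  have "\<exists>v. \<forall>u. K u \<bullet> w = v \<bullet> u" for w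
    using riesz_representation[OF bounded_linear_compose[OF bounded_linear_inner_left assms]]
    by metis
  then obtain A where "\<forall>u w. K u \<bullet> w = u \<bullet> A w"
    by (metis inner_commute)
  then show ?thesis
    using adjoint_unique by blast
qed

section \<open>Convex conjugates\<close>

lemma conjugate_ge: "ereal (w \<bullet> z) - \<phi> z \<le> conjugate \<phi> w"
  unfolding conjugate_def by (rule SUP_upper) simp

text \<open>A subgradient \<open>q\<close> at a proximal point yields an affine minorant of
  \<open>\<phi>\<close>, which bounds the conjugate at \<open>q\<close> from above.\<close>

lemma proper_conjugate:
  fixes \<phi> :: "'a::{real_inner,complete_space} \<Rightarrow> ereal"
  assumes "proper_convex_lsc \<phi>"
  shows "proper (conjugate \<phi>)"
proof -
  note p = proper_convex_lscD[OF assms]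
  obtain z where "is_prox 1 \<phi> 0 z"
    using ex_is_prox[OF assms] by (metis zero_less_one)
  from is_prox_subgradient[OF p(1,2) zero_less_one this]
  obtain q where z: "z \<in> edom \<phi>" and q: "q \<in> subdiff \<phi> z"
    by blast
  define c where "c = real_of_ereal (\<phi> z)"
  have c: "\<phi> z = ereal c"
    using proper_ereal[OF p(1) z] by (simp add: c_def)
  have "conjugate \<phi> w \<noteq> - \<infinity>" for w
    using conjugate_ge[of w z \<phi>] c by auto
  moreover have "conjugate \<phi> q \<le> ereal (q \<bullet> z - c)"
    unfolding conjugate_def
  proof (rule SUP_least)
    fix u
    have "\<phi> u \<ge> ereal (c + q \<bullet> (u - z))"
      using q c by (simp add: subdiff_def)
    then show "ereal (q \<bullet> u) - \<phi> u \<le> ereal (q \<bullet> z - c)"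
      by (cases "\<phi> u") (auto simp: inner_simps)
  qed
  then have "q \<in> edom (conjugate \<phi>)"
    by (auto simp: edom_def intro: le_less_trans)
  ultimately show ?thesis
    by (auto simp: proper_def)
qed

text \<open>The conjugate is a supremum of affine functions indexed by the domain of
  \<open>\<phi>\<close>; all other points contribute \<open>-\<infinity>\<close>.\<close>

lemma econvex_conjugate:
  assumes "proper \<phi>"
  shows "econvex (conjugate \<phi>)"
proof -
  obtain z0 where "z0 \<in> edom \<phi>"
    using assms by (auto simp: proper_def)
  then have "conjugate \<phi> w \<noteq> - \<infinity>" for w
    using conjugate_ge[of w z0 \<phi>] proper_ereal[OF assms] by (metis ereal_minus(1) ereal_infty_less_eq2(2) PInfty_neq_ereal(1) MInfty_neq_ereal(1))
  note fin = this
  show ?thesis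
    unfolding econvex_def
  proof (intro allI ballI)
    fix a b :: 'a and t :: real assume t: "t \<in> {0..1}"
    show "conjugate \<phi> ((1 - t) *\<^sub>R a + t *\<^sub>R b)
        \<le> ereal (1 - t) * conjugate \<phi> a + ereal t * conjugate \<phi> b"
      unfolding conjugate_def[of \<phi> "(1 - t) *\<^sub>R a + t *\<^sub>R b"]
    proof (rule SUP_least)
      fix z
      show "ereal (((1 - t) *\<^sub>R a + t *\<^sub>R b) \<bullet> z) - \<phi> z
          \<le> ereal (1 - t) * conjugate \<phi> a + ereal t * conjugate \<phi> b"
      proof (cases "z \<in> edom \<phi>")
        case False
        then show ?thesis
          by (simp add: edom_def)
      next
        case True
        define c where "c = real_of_ereal (\<phi> z)"
        have c: "\<phi> z = ereal c"
          using proper_ereal[OF assms True] by (simp add: c_def)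
        have "ereal (((1 - t) *\<^sub>R a + t *\<^sub>R b) \<bullet> z) - \<phi> z
            = ereal (1 - t) * ereal (a \<bullet> z - c) + ereal t * ereal (b \<bullet> z - c)"
          by (simp add: c inner_simps algebra_simps)
        also have "\<dots> \<le> ereal (1 - t) * conjugate \<phi> a + ereal t * conjugate \<phi> b"
          using t conjugate_ge[of a z \<phi>] conjugate_ge[of b z \<phi>] c
          by (intro add_mono ereal_mult_left_mono) auto
        finally show ?thesis .
      qed
    qed
  qed
qed

section \<open>Inexact proximal points of strongly convex functions\<close>

lemma strongly_convexD:
  assumes "proper g" "strongly_convex \<gamma> g" "q \<in> subdiff g w" "w \<in> edom g" "u \<in> edom g"
  shows "real_of_ereal (g w) + q \<bullet> (u - w) + \<gamma> / 2 * (norm (u - w))\<^sup>2 \<le> real_of_ereal (g u)"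
proof -
  have "g w + ereal (q \<bullet> (u - w)) + ereal (\<gamma> / 2 * (norm (u - w))\<^sup>2) \<le> g u"
    using assms(2,3) unfolding strongly_convex_def by blast
  then show ?thesis
    using proper_ereal[OF assms(1,4)] proper_ereal[OF assms(1,5)]
    by (metis ereal_less_eq(3) plus_ereal.simps(1))
qed

lemma eps_subdiffD:
  assumes "proper \<phi>" "p \<in> eps_subdiff \<epsilon> \<phi> z"
  shows "z \<in> edom \<phi>"
    and "u \<in> edom \<phi> \<Longrightarrow>
      real_of_ereal (\<phi> z) + p \<bullet> (u - z) - \<epsilon> \<le> real_of_ereal (\<phi> u)"
proof -
  have le: "\<phi> z + ereal (p \<bullet> (u - z)) - ereal \<epsilon> \<le> \<phi> u" for u
    using assms(2) by (simp add: eps_subdiff_def)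
  obtain w where w: "w \<in> edom \<phi>"
    using assms(1) by (auto simp: proper_def)
  show z: "z \<in> edom \<phi>"
    using le[of w] w by (cases "\<phi> z") (auto simp: edom_def)
  show "real_of_ereal (\<phi> z) + p \<bullet> (u - z) - \<epsilon> \<le> real_of_ereal (\<phi> u)"
    if "u \<in> edom \<phi>"
    using le[of u] proper_ereal[OF assms(1) z] proper_ereal[OF assms(1) that]
    by (metis ereal_less_eq(3) plus_ereal.simps(1) ereal_minus(1))
qed

text \<open>Turns a bound on a squared distance into the coefficient of a linear error. The factor 4
  leaves slack for types 1 and 3, so that the constant agrees with the one for type 2.\<close>

lemma mult_le_sqrt:
  fixes m B \<epsilon> :: real
  assumes "m > 0" "m * B\<^sup>2 \<le> 4 * \<epsilon>"
  shows "m * B \<le> 2 * sqrt (\<epsilon> * m)"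
proof -
  have "(m * B)\<^sup>2 \<le> 4 * (\<epsilon> * m)"
    using mult_left_mono[OF assms(2), of m] assms(1)
    by (simp add: power_mult_distrib power2_eq_square algebra_simps)
  then have "m * B \<le> sqrt (4 * (\<epsilon> * m))"
    by (rule real_le_rsqrt)
  then show ?thesis
    by (simp add: real_sqrt_mult)
qed

text \<open>Moving the centre of a square leaves a cross term, which Cauchy-Schwarz makes linear in
  the distance to the test point.\<close>

lemma quadratic_perturbation:
  fixes a b :: "'a::real_inner"
  assumes "m \<ge> 0" "m * norm b \<le> \<eta>"
  shows "- (\<eta> * norm a) \<le> m * (a \<bullet> b)"
proof -
  have "- (m * (a \<bullet> b)) \<le> m * (norm a * norm b)"
    using assms(1) Cauchy_Schwarz_ineq2[of a b]
    by (metis abs_ge_minus_self mult_left_mono mult_minus_right order_trans)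
  also have "\<dots> \<le> \<eta> * norm a"
    using mult_right_mono[OF assms(2), of "norm a"] by (simp add: algebra_simps)
  finally show ?thesis
    by simp
qed

text \<open>For each kind of inexactness there is a nearby point \<open>w\<close> with an exact subgradient; applying
  strong convexity at \<open>w\<close> keeps the full modulus \<open>\<gamma>\<close>, at the price of an error that is linear in
  \<open>norm (u - z)\<close> and hence acts like an additional gradient error.\<close>

lemma approx_prox1_inequality:
  fixes g :: "'a::{real_inner,complete_space} \<Rightarrow> ereal"
  assumes g: "proper_convex_lsc g" and str: "strongly_convex \<gamma> g" "\<gamma> > 0" and \<mu>: "\<mu> > 0"
    and z: "approx_prox1 \<epsilon> \<mu> g v z" and u: "u \<in> edom g"
  shows "z \<in> edom g"
    and "real_of_ereal (g z) + (v - z) \<bullet> (u - z) / \<mu> + \<gamma> / 2 * (norm (u - z))\<^sup>2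
      - 2 * sqrt (\<epsilon> * (\<gamma> + 1 / \<mu>)) * norm (u - z) - \<epsilon> \<le> real_of_ereal (g u)"
proof -
  note p = proper_convex_lscD[OF g]
  let ?r = "\<lambda>u. real_of_ereal (g u)"
  let ?\<Phi> = "prox_objective \<mu> g v"
  let ?o = "\<lambda>u. 1 / (2 * \<mu>) * (norm (u - v))\<^sup>2 + ?r u"
  have edom: "edom ?\<Phi> = edom g"
  proof -
    have "?\<Phi> w < \<infinity> \<longleftrightarrow> g w < \<infinity>" for w
      by (cases "g w") (auto simp: prox_objective_def)
    then show ?thesis
      by (simp add: edom_def)
  qed
  have "?\<Phi> w \<noteq> - \<infinity>" for w
    using p(1) by (cases "g w") (auto simp: prox_objective_def proper_def)
  then have proper: "proper ?\<Phi>"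
    using p(1) edom by (simp add: proper_def)
  have o: "real_of_ereal (?\<Phi> w) = ?o w" if "w \<in> edom g" for w
  proof -
    show ?thesis
      unfolding prox_objective_def by (subst proper_ereal[OF p(1) that]) simp
  qed
  note eps = eps_subdiffD[OF proper z[unfolded approx_prox1_def]]
  show zd: "z \<in> edom g"
    using eps(1) edom by simp
  obtain w where w: "is_prox \<mu> g v w"
    by (rule ex_is_prox[OF g \<mu>])
  note sub = is_prox_subgradient[OF p(1,2) \<mu> w]
  have near: "?o z - \<epsilon> \<le> ?o w"
    using eps(2)[of w] sub(1) zd by (simp add: edom o)
  define m where "m = \<gamma> + 1 / \<mu>"
  have m: "m > 0"
    using str(2) \<mu> by (simp add: m_def add_pos_pos)
  \<comment> \<open>The objective has modulus \<open>\<gamma>\<close> from \<open>g\<close> and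
    \<open>1 / \<mu>\<close> from the quadratic, so it grows with \<open>m\<close> around its exact
    minimiser \<open>w\<close>.\<close>
  have grow: "?o w + m / 2 * (norm (t - w))\<^sup>2 \<le> ?o t" if "t \<in> edom g" for t
  proof -
    have "?r w + (1 / \<mu>) *\<^sub>R (v - w) \<bullet> (t - w) + \<gamma> / 2 * (norm (t - w))\<^sup>2 \<le> ?r t"
      by (rule strongly_convexD[OF p(1) str(1) sub(2,1) that])
    moreover have "1 / (2 * \<mu>) * (norm (t - v))\<^sup>2
        = 1 / (2 * \<mu>) * (norm (w - v))\<^sup>2 - (1 / \<mu>) *\<^sub>R (v - w) \<bullet> (t - w)
          + 1 / (2 * \<mu>) * (norm (t - w))\<^sup>2"
      unfolding power2_norm_eq_inner
      using \<mu> by (simp add: inner_simps inner_commute field_simps)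
    ultimately show ?thesis
      by (simp add: m_def algebra_simps add_divide_distrib)
  qed
  have "m / 2 * (norm (z - w))\<^sup>2 \<le> \<epsilon>" "0 \<le> m / 2 * (norm (z - w))\<^sup>2"
    using grow[OF zd] near m by auto
  then have "m * (norm (z - w))\<^sup>2 \<le> 4 * \<epsilon>"
    by linarith
  then have "m * norm (z - w) \<le> 2 * sqrt (\<epsilon> * m)"
    by (rule mult_le_sqrt[OF m])
  then have pert: "- (2 * sqrt (\<epsilon> * m) * norm (u - z)) \<le> m * ((u - z) \<bullet> (z - w))"
    using m by (intro quadratic_perturbation) auto
  have "m / 2 * (norm (u - w))\<^sup>2
      = m / 2 * (norm (u - z))\<^sup>2 + m * ((u - z) \<bullet> (z - w)) + m / 2 * (norm (z - w))\<^sup>2"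
    unfolding power2_norm_eq_inner by (simp add: inner_simps inner_commute algebra_simps)
  moreover have "0 \<le> m / 2 * (norm (z - w))\<^sup>2"
    using m by simp
  ultimately have "?o z - \<epsilon> + m / 2 * (norm (u - z))\<^sup>2 - 2 * sqrt (\<epsilon> * m) * norm (u - z) \<le> ?o u"
    using grow[OF u] near pert by linarith
  \<comment> \<open>Back from the objective to \<open>g\<close>: the share \<open>1 / \<mu>\<close>
    of \<open>m\<close> cancels against the expansion of the quadratic about \<open>z\<close>, and
    \<open>\<gamma>\<close> remains.\<close>
  moreover have "1 / (2 * \<mu>) * (norm (u - v))\<^sup>2
      = 1 / (2 * \<mu>) * (norm (z - v))\<^sup>2 - (v - z) \<bullet> (u - z) / \<mu> + 1 / (2 * \<mu>) * (norm (u - z))\<^sup>2"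
    unfolding power2_norm_eq_inner
    using \<mu> by (simp add: inner_simps inner_commute field_simps)
  moreover have "m / 2 * (norm (u - z))\<^sup>2
      = \<gamma> / 2 * (norm (u - z))\<^sup>2 + 1 / (2 * \<mu>) * (norm (u - z))\<^sup>2"
    by (simp add: m_def algebra_simps add_divide_distrib)
  ultimately show "?r z + (v - z) \<bullet> (u - z) / \<mu> + \<gamma> / 2 * (norm (u - z))\<^sup>2
      - 2 * sqrt (\<epsilon> * (\<gamma> + 1 / \<mu>)) * norm (u - z) - \<epsilon> \<le> ?r u"
    unfolding m_def by linarith
qed

lemma approx_prox2_inequality:
  fixes g :: "'a::{real_inner,complete_space} \<Rightarrow> ereal"
  assumes g: "proper_convex_lsc g" and str: "strongly_convex \<gamma> g" "\<gamma> > 0"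
    and z: "approx_prox2 \<epsilon> \<mu> g v z" and u: "u \<in> edom g"
  shows "z \<in> edom g"
    and "real_of_ereal (g z) + (v - z) \<bullet> (u - z) / \<mu> + \<gamma> / 2 * (norm (u - z))\<^sup>2
      - 2 * sqrt (\<epsilon> * \<gamma>) * norm (u - z) - \<epsilon> \<le> real_of_ereal (g u)"
proof -
  note p = proper_convex_lscD[OF g]
  let ?r = "\<lambda>u. real_of_ereal (g u)"
  define q where "q = (1 / \<mu>) *\<^sub>R (v - z)"
  note eps = eps_subdiffD[OF p(1) z[unfolded approx_prox2_def, folded q_def]]
  show zd: "z \<in> edom g"
    by (rule eps(1))
  have inv: "1 / \<gamma> > 0"
    using str(2) by simp
  \<comment> \<open>Parameter and centre are chosen so that the exact subgradient at
    \<open>w\<close> is \<open>q + \<gamma> *\<^sub>R (z - w)\<close>, a perturbation of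
    \<open>q\<close> that is bounded independently of \<open>\<mu>\<close>.\<close>
  obtain w where w: "is_prox (1 / \<gamma>) g (z + (1 / \<gamma>) *\<^sub>R q) w"
    by (rule ex_is_prox[OF g inv])
  note sub = is_prox_subgradient[OF p(1,2) inv w]
  have "(1 / (1 / \<gamma>)) *\<^sub>R (z + (1 / \<gamma>) *\<^sub>R q - w) = q + \<gamma> *\<^sub>R (z - w)"
    using str(2) by (simp add: algebra_simps)
  with sub(2) have q: "q + \<gamma> *\<^sub>R (z - w) \<in> subdiff g w"
    by simp
  have grow: "?r z - \<epsilon> + q \<bullet> (t - z) + \<gamma> / 2 * (norm (t - z))\<^sup>2
      + 2 * (\<gamma> * ((t - z) \<bullet> (z - w))) + 3 / 2 * (\<gamma> * (norm (z - w))\<^sup>2) \<le> ?r t"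
    if "t \<in> edom g" for t
  proof -
    have "?r w + (q + \<gamma> *\<^sub>R (z - w)) \<bullet> (t - w) + \<gamma> / 2 * (norm (t - w))\<^sup>2 \<le> ?r t"
      by (rule strongly_convexD[OF p(1) str(1) q sub(1) that])
    moreover have "?r z + q \<bullet> (w - z) - \<epsilon> \<le> ?r w"
      by (rule eps(2)[OF sub(1)])
    moreover have "(q + \<gamma> *\<^sub>R (z - w)) \<bullet> (t - w) + \<gamma> / 2 * (norm (t - w))\<^sup>2 + q \<bullet> (w - z)
        = q \<bullet> (t - z) + \<gamma> / 2 * (norm (t - z))\<^sup>2
      + 2 * (\<gamma> * ((t - z) \<bullet> (z - w))) + 3 / 2 * (\<gamma> * (norm (z - w))\<^sup>2)"
      unfolding power2_norm_eq_inner by (simp add: inner_simps inner_commute algebra_simps)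
    ultimately show ?thesis
      by linarith
  qed
  have pos: "0 \<le> \<gamma> * (norm (z - w))\<^sup>2"
    using str(2) by simp
  \<comment> \<open>Testing at \<open>z\<close> itself removes every term but
    \<open>\<epsilon>\<close> and the last square.\<close>
  have "\<gamma> * (norm (z - w))\<^sup>2 \<le> \<epsilon>"
    using grow[OF zd] pos by simp
  have "(\<gamma> * norm (z - w))\<^sup>2 \<le> \<epsilon> * \<gamma>"
    using mult_left_mono[OF \<open>\<gamma> * (norm (z - w))\<^sup>2 \<le> \<epsilon>\<close>, of \<gamma>] str(2)
    by (simp add: power_mult_distrib power2_eq_square algebra_simps)
  then have "\<gamma> * norm (z - w) \<le> sqrt (\<epsilon> * \<gamma>)"
    by (rule real_le_rsqrt)
  then have pert: "- (sqrt (\<epsilon> * \<gamma>) * norm (u - z)) \<le> \<gamma> * ((u - z) \<bullet> (z - w))"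
    using str(2) by (intro quadratic_perturbation) auto
  have "?r z + q \<bullet> (u - z) + \<gamma> / 2 * (norm (u - z))\<^sup>2
      - 2 * sqrt (\<epsilon> * \<gamma>) * norm (u - z) - \<epsilon> \<le> ?r u"
    using grow[OF u] pert pos by linarith
  then show "?r z + (v - z) \<bullet> (u - z) / \<mu> + \<gamma> / 2 * (norm (u - z))\<^sup>2
      - 2 * sqrt (\<epsilon> * \<gamma>) * norm (u - z) - \<epsilon> \<le> ?r u"
    by (simp add: q_def)
qed

text \<open>The point \<open>z\<close> itself carries an exact subgradient, displaced by
  \<open>s\<close> divided by \<open>\<mu>\<close>. The coefficient is enlarged from
  \<open>1 / \<mu>\<close> to \<open>\<gamma> + 1 / \<mu>\<close> so that types 1 and 3 share one
  estimate.\<close>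

lemma approx_prox3_inequality:
  fixes g :: "'a::{real_inner,complete_space} \<Rightarrow> ereal"
  assumes g: "proper_convex_lsc g" and str: "strongly_convex \<gamma> g" "\<gamma> > 0" and \<mu>: "\<mu> > 0"
    and \<epsilon>: "\<epsilon> \<ge> 0" and z: "approx_prox3 \<epsilon> \<mu> g v z" and u: "u \<in> edom g"
  shows "z \<in> edom g"
    and "real_of_ereal (g z) + (v - z) \<bullet> (u - z) / \<mu> + \<gamma> / 2 * (norm (u - z))\<^sup>2
      - 2 * sqrt (\<epsilon> * (\<gamma> + 1 / \<mu>)) * norm (u - z) - \<epsilon> \<le> real_of_ereal (g u)"
proof -
  note p = proper_convex_lscD[OF g]
  let ?r = "\<lambda>u. real_of_ereal (g u)"
  obtain s where s: "norm s \<le> sqrt (2 * \<mu> * \<epsilon>)" "is_prox \<mu> g (v + s) z"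
    using z by (auto simp: approx_prox3_def)
  note sub = is_prox_subgradient[OF p(1,2) \<mu> s(2)]
  show zd: "z \<in> edom g"
    by (rule sub(1))
  have "(norm s)\<^sup>2 \<le> (sqrt (2 * \<mu> * \<epsilon>))\<^sup>2"
    by (rule power_mono[OF s(1)]) simp
  then have "1 / \<mu> * (norm s)\<^sup>2 \<le> 2 * \<epsilon>"
    using \<mu> \<epsilon> by (simp add: field_simps)
  then have "1 / \<mu> * (norm s)\<^sup>2 \<le> 4 * \<epsilon>"
    using \<epsilon> by linarith
  then have "1 / \<mu> * norm s \<le> 2 * sqrt (\<epsilon> * (1 / \<mu>))"
    using \<mu> by (intro mult_le_sqrt) auto
  also have "\<dots> \<le> 2 * sqrt (\<epsilon> * (\<gamma> + 1 / \<mu>))"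
    using \<epsilon> str(2) by (intro mult_left_mono real_sqrt_le_mono) auto
  finally have "- (2 * sqrt (\<epsilon> * (\<gamma> + 1 / \<mu>)) * norm (u - z)) \<le> 1 / \<mu> * ((u - z) \<bullet> s)"
    using \<mu> by (intro quadratic_perturbation) auto
  moreover have "?r z + (1 / \<mu>) *\<^sub>R (v + s - z) \<bullet> (u - z) + \<gamma> / 2 * (norm (u - z))\<^sup>2 \<le> ?r u"
    by (rule strongly_convexD[OF p(1) str(1) sub(2,1) u])
  moreover have "(1 / \<mu>) *\<^sub>R (v + s - z) \<bullet> (u - z)
      = (v - z) \<bullet> (u - z) / \<mu> + 1 / \<mu> * ((u - z) \<bullet> s)"
    by (simp add: inner_simps inner_commute field_simps add_divide_distrib diff_divide_distrib)
  ultimately show "?r z + (v - z) \<bullet> (u - z) / \<mu> + \<gamma> / 2 * (norm (u - z))\<^sup>2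
      - 2 * sqrt (\<epsilon> * (\<gamma> + 1 / \<mu>)) * norm (u - z) - \<epsilon> \<le> ?r u"
    using \<epsilon> by linarith
qed

text \<open>The branch in the linear coefficient explains the different rates asked of
  \<open>\<epsilon>\<close>: when \<open>1 / \<mu>\<close> grows linearly, types 1 and 3 need one
  more power of decay.\<close>

lemma approx_prox_inequality:
  fixes g :: "'a::{real_inner,complete_space} \<Rightarrow> ereal"
  assumes "proper_convex_lsc g" "strongly_convex \<gamma> g" "\<gamma> > 0" "\<mu> > 0" "\<epsilon> \<ge> 0"
    and "approx_prox i \<epsilon> \<mu> g v z" "u \<in> edom g"
  shows "z \<in> edom g"
    and "real_of_ereal (g z) + (v - z) \<bullet> (u - z) / \<mu> + \<gamma> / 2 * (norm (u - z))\<^sup>2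
      - 2 * sqrt (\<epsilon> * (if i = 2 then \<gamma> else \<gamma> + 1 / \<mu>)) * norm (u - z) - \<epsilon>
      \<le> real_of_ereal (g u)"
proof -
  consider "i = 1" "approx_prox1 \<epsilon> \<mu> g v z" | "i = 2" "approx_prox2 \<epsilon> \<mu> g v z"
    | "i = 3" "approx_prox3 \<epsilon> \<mu> g v z"
    using assms(6) unfolding approx_prox_def by blast
  then have "z \<in> edom g \<and> real_of_ereal (g z) + (v - z) \<bullet> (u - z) / \<mu> + \<gamma> / 2 * (norm (u - z))\<^sup>2
      - 2 * sqrt (\<epsilon> * (if i = 2 then \<gamma> else \<gamma> + 1 / \<mu>)) * norm (u - z) - \<epsilon>
      \<le> real_of_ereal (g u)"
  proof cases
    case 1
    then show ?thesis
      using approx_prox1_inequality[OF assms(1-4) 1(2) assms(7)] by simp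
  next
    case 2
    then show ?thesis
      using approx_prox2_inequality[OF assms(1-3) 2(2) assms(7)] by simp
  next
    case 3
    then show ?thesis
      using approx_prox3_inequality[OF assms(1-5) 3(2) assms(7)] by simp
  qed
  then show "z \<in> edom g"
    and "real_of_ereal (g z) + (v - z) \<bullet> (u - z) / \<mu> + \<gamma> / 2 * (norm (u - z))\<^sup>2
      - 2 * sqrt (\<epsilon> * (if i = 2 then \<gamma> else \<gamma> + 1 / \<mu>)) * norm (u - z) - \<epsilon>
      \<le> real_of_ereal (g u)"
    by blast+
qed

section \<open>Smooth convex functions\<close>

text \<open>Uniqueness of the Frechet derivative makes the definite description in
  \<open>egradient\<close> meaningful.\<close>

lemma has_egradient_egradient:
  assumes "differentiable_on_edom \<phi>" "x \<in> edom \<phi>"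
  shows "has_egradient \<phi> x (egradient \<phi> x)"
proof -
  obtain d where d: "has_egradient \<phi> x d"
    using assms by (auto simp: differentiable_on_edom_def)
  have "d' = d" if "has_egradient \<phi> x d'" for d'
  proof -
    have "(\<lambda>h. h \<bullet> d') = (\<lambda>h. h \<bullet> d)"
      using d that unfolding has_egradient_def gderiv_def
      by (blast intro: has_derivative_unique)
    then show ?thesis
      by (metis vector_eq_ldot)
  qed
  with d show ?thesis
    unfolding egradient_def by (rule theI)
qed

lemma GDERIV_line:
  assumes "GDERIV \<phi> (x + t *\<^sub>R d) :> D"
  shows "((\<lambda>t. \<phi> (x + t *\<^sub>R d)) has_real_derivative D \<bullet> d) (at t)"
proof -
  have "((\<lambda>t. x + t *\<^sub>R d) has_derivative (\<lambda>t. t *\<^sub>R d)) (at t)"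
    by (auto intro!: derivative_eq_intros)
  from has_derivative_compose[OF this assms[unfolded gderiv_def]]
  show ?thesis
    by (auto simp: has_field_derivative_def inner_commute mult_commute_abs elim!: has_derivative_eq_rhs)
qed

text \<open>Convexity keeps the difference quotients towards \<open>y\<close> below the chord slope,
  and this survives the one-sided limit at 0.\<close>

lemma convex_on_above_tangent_GDERIV:
  assumes conv: "convex_on S \<phi>" and xy: "x \<in> S" "y \<in> S" and grad: "GDERIV \<phi> x :> D"
  shows "\<phi> x + D \<bullet> (y - x) \<le> \<phi> y"
proof -
  define \<psi> where "\<psi> t = \<phi> (x + t *\<^sub>R (y - x))" for t
  have "(\<psi> has_real_derivative D \<bullet> (y - x)) (at 0)"
    unfolding \<psi>_def by (rule GDERIV_line) (simp add: grad)
  then have "((\<lambda>h. (\<psi> h - \<psi> 0) / h) \<longlongrightarrow> D \<bullet> (y - x)) (at_right 0)"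
    unfolding DERIV_def by (simp add: filterlim_at_split)
  moreover have "(\<psi> h - \<psi> 0) / h \<le> \<phi> y - \<phi> x" if h: "0 < h" "h < 1" for h
  proof -
    have "\<psi> h = \<phi> ((1 - h) *\<^sub>R x + h *\<^sub>R y)"
      by (simp add: \<psi>_def algebra_simps)
    also have "\<dots> \<le> (1 - h) * \<phi> x + h * \<phi> y"
      using h by (intro convex_onD[OF conv] xy) auto
    finally show ?thesis
      using h by (simp add: \<psi>_def field_simps)
  qed
  then have "\<forall>\<^sub>F h in at_right 0. (\<psi> h - \<psi> 0) / h \<le> \<phi> y - \<phi> x"
    by (intro eventually_at_rightI[of 0 1]) auto
  ultimately have "D \<bullet> (y - x) \<le> \<phi> y - \<phi> x"
    by (rule tendsto_upperbound) simp
  then show ?thesis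
    by simp
qed

text \<open>After subtracting the linear and quadratic parts along the segment, the Lipschitz bound
  leaves a nonincreasing function.\<close>

lemma descent_lemma:
  fixes \<phi> :: "'a::real_inner \<Rightarrow> real"
  assumes grad: "\<And>x. GDERIV \<phi> x :> G x" and lip: "\<And>x y. norm (G x - G y) \<le> M * norm (x - y)"
  shows "\<phi> y \<le> \<phi> x + G x \<bullet> (y - x) + M / 2 * (norm (y - x))\<^sup>2"
proof -
  define d where "d = y - x"
  define \<psi> where "\<psi> t = \<phi> (x + t *\<^sub>R d) - t * (G x \<bullet> d) - M / 2 * t\<^sup>2 * (norm d)\<^sup>2" for t
  have der: "(\<psi> has_real_derivative G (x + t *\<^sub>R d) \<bullet> d - G x \<bullet> d - M * t * (norm d)\<^sup>2) (at t)" for t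
    unfolding \<psi>_def by (auto intro!: derivative_eq_intros GDERIV_line grad)
  have "\<psi> 1 \<le> \<psi> 0"
  proof (rule DERIV_nonpos_imp_nonincreasing[of 0 1 \<psi>])
    fix t :: real assume t: "0 \<le> t" "t \<le> 1"
    have "(G (x + t *\<^sub>R d) - G x) \<bullet> d \<le> norm (G (x + t *\<^sub>R d) - G x) * norm d"
      by (rule norm_cauchy_schwarz)
    also have "\<dots> \<le> M * norm (x + t *\<^sub>R d - x) * norm d"
      by (intro mult_right_mono lip) simp
    also have "\<dots> = M * t * (norm d)\<^sup>2"
      using t by (simp add: power2_eq_square)
    finally show "\<exists>y. (\<psi> has_real_derivative y) (at t) \<and> y \<le> 0"
      using der[of t] by (auto simp: inner_simps)
  qed simp
  then show ?thesis
    by (simp add: \<psi>_def d_def)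
qed

text \<open>A Lipschitz gradient keeps \<open>\<phi>\<close> bounded near boundary points of its open domain, so by lower
  semicontinuity the domain is closed as well.\<close>

lemma edom_eq_UNIV:
  fixes \<phi> :: "'a::real_inner \<Rightarrow> ereal"
  assumes \<phi>: "proper_convex_lsc \<phi>" and diff: "differentiable_on_edom \<phi>"
    and lip: "\<And>u u'. u \<in> edom \<phi> \<Longrightarrow> u' \<in> edom \<phi> \<Longrightarrow>
      norm (egradient \<phi> u - egradient \<phi> u') \<le> M * norm (u - u')"
  shows "edom \<phi> = UNIV"
proof -
  note p = proper_convex_lscD[OF \<phi>]
  let ?r = "\<lambda>u. real_of_ereal (\<phi> u)" and ?G = "egradient \<phi>"
  note grad = has_egradient_egradient[OF diff, unfolded has_egradient_def]
  have "open (edom \<phi>)"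
    using grad interior_subset by (metis open_interior subsetI subset_antisym)
  moreover have "closed (edom \<phi>)"
    unfolding closed_sequential_limits
  proof (intro allI impI, elim conjE)
    fix X u assume X: "\<forall>k. X k \<in> edom \<phi>" "X \<longlonglongrightarrow> u"
    obtain x where x: "x \<in> edom \<phi>"
      using p(1) by (auto simp: proper_def)
    have "\<phi> u \<le> ereal (?r x + (norm (?G x) + M * norm (u - x)) * norm (u - x))"
    proof (rule lower_semicont_sequentially[OF p(3) X(2)])
      fix k
      \<comment> \<open>The tangent at \<open>X k\<close> is evaluated at the fixed
        \<open>x\<close>, so the value at \<open>X k\<close> is bounded through its own gradient,
        which the Lipschitz condition ties to the gradient at \<open>x\<close>.\<close>
      have "?r (X k) + ?G (X k) \<bullet> (x - X k) \<le> ?r x"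
        using X x grad by (intro convex_on_above_tangent_GDERIV[OF convex_on_edom[OF p(1,2)]]) auto
      moreover have "- (?G (X k) \<bullet> (x - X k)) \<le> norm (?G (X k)) * norm (X k - x)"
        using norm_cauchy_schwarz[of "?G (X k)" "X k - x"] by (simp add: inner_simps)
      moreover have "norm (?G (X k)) \<le> norm (?G x) + M * norm (X k - x)"
        using lip[of "X k" x] X x norm_triangle_ineq2[of "?G (X k)" "?G x"] by fastforce
      then have "norm (?G (X k)) * norm (X k - x)
          \<le> (norm (?G x) + M * norm (X k - x)) * norm (X k - x)"
        by (rule mult_right_mono) simp
      ultimately have "?r (X k) \<le> ?r x + (norm (?G x) + M * norm (X k - x)) * norm (X k - x)"
        by linarith
      then show "\<phi> (X k) \<le> ereal (?r x + (norm (?G x) + M * norm (X k - x)) * norm (X k - x))"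
        using X(1) proper_ereal[OF p(1)] by (metis ereal_less_eq(3))
    qed (intro tendsto_intros X)
    then show "u \<in> edom \<phi>"
      by (auto simp: edom_def intro: le_less_trans)
  qed
  moreover have "edom \<phi> \<noteq> {}"
    using p(1) by (simp add: proper_def)
  ultimately show ?thesis
    using clopen by blast
qed

section \<open>The primal-dual energy\<close>

text \<open>Function values are plain reals here, so the step is pure algebra: the proximal
  inequalities and the two bounds on \<open>f\<close> are added, and three-point identities turn
  inner products into squared distances.\<close>

lemma primal_dual_step:
  fixes K :: "'a::real_inner \<Rightarrow> 'b::real_inner"
  assumes K: "linear K" and adj: "\<And>u w. K u \<bullet> w = u \<bullet> A w" and pos: "\<tau> > 0" "\<sigma> > 0"
    and x_ineq: "gx' + (x - \<tau> *\<^sub>R (A y' + D + e) - x') \<bullet> (xs - x') / \<tau>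
      + \<gamma> / 2 * (norm (xs - x'))\<^sup>2 - \<eta> * norm (xs - x') - \<epsilon> \<le> gxs"
    and y_ineq: "hy' + (1 / \<sigma>) *\<^sub>R (y + \<sigma> *\<^sub>R K xt - y') \<bullet> (ys - y') - \<delta> \<le> hys"
    and f_upper: "fx' \<le> fx + D \<bullet> (x' - x) + M / 2 * (norm (x' - x))\<^sup>2"
    and f_lower: "fx + D \<bullet> (xs - x) \<le> fxs"
  shows "(K x' \<bullet> ys + fx' + gx' - hys) - (K xs \<bullet> y' + fxs + gxs - hy')
      + (1 / (2 * \<tau>) + \<gamma> / 2) * (norm (xs - x'))\<^sup>2 + 1 / (2 * \<sigma>) * (norm (ys - y'))\<^sup>2
      + (1 / (2 * \<tau>) - M / 2) * (norm (x' - x))\<^sup>2 + 1 / (2 * \<sigma>) * (norm (y' - y))\<^sup>2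
    \<le> 1 / (2 * \<tau>) * (norm (xs - x))\<^sup>2 + 1 / (2 * \<sigma>) * (norm (ys - y))\<^sup>2
      + K (x' - xt) \<bullet> (ys - y') + ((norm e + \<eta>) * norm (xs - x') + (\<epsilon> + \<delta>))"
proof -
  have 1: "(x - \<tau> *\<^sub>R (A y' + D + e) - x') \<bullet> (xs - x') / \<tau>
      = 1 / (2 * \<tau>) * ((norm (x' - x))\<^sup>2 + (norm (xs - x'))\<^sup>2 - (norm (xs - x))\<^sup>2)
        - K (xs - x') \<bullet> y' - D \<bullet> (xs - x') - e \<bullet> (xs - x')"
    unfolding power2_norm_eq_inner adj
    using pos by (simp add: inner_simps inner_commute field_simps)
  have 2: "(1 / \<sigma>) *\<^sub>R (y + \<sigma> *\<^sub>R K xt - y') \<bullet> (ys - y')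
      = 1 / (2 * \<sigma>) * ((norm (y' - y))\<^sup>2 + (norm (ys - y'))\<^sup>2 - (norm (ys - y))\<^sup>2)
        + K xt \<bullet> (ys - y')"
    unfolding power2_norm_eq_inner
    using pos by (simp add: inner_simps inner_commute field_simps)
  have 3: "K (x' - xt) \<bullet> (ys - y') = K x' \<bullet> ys - K x' \<bullet> y' - K xt \<bullet> (ys - y')"
    "K (xs - x') \<bullet> y' = K xs \<bullet> y' - K x' \<bullet> y'"
    by (simp_all add: linear_diff[OF K] inner_simps)
  have 4: "e \<bullet> (xs - x') \<le> norm e * norm (xs - x')"
    by (rule norm_cauchy_schwarz)
  \<comment> \<open>The gradient terms of the proximal step and of the two bounds on
    \<open>f\<close> cancel exactly.\<close>
  have 5: "D \<bullet> (x' - x) - D \<bullet> (xs - x) + D \<bullet> (xs - x') = 0"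
    by (simp add: inner_simps)
  show ?thesis
    using x_ineq y_ineq f_upper f_lower 4 5 unfolding 1 2 3 by (simp add: algebra_simps)
qed

text \<open>The whole weight goes on the primal factor, so that the other square matches the dual
  terms. This absorbs the coupling remainder and also bounds the energy from below.\<close>

lemma weighted_young:
  fixes K :: "'a::real_normed_vector \<Rightarrow> 'b::real_inner"
  assumes "bounded_linear K" "\<rho> \<ge> 0"
  shows "\<bar>\<rho> * (K d \<bullet> w)\<bar> \<le> 1 / 2 * (\<rho> * onorm K * norm d)\<^sup>2 + 1 / 2 * (norm w)\<^sup>2"
proof -
  have "\<bar>\<rho> * (K d \<bullet> w)\<bar> \<le> \<rho> * (norm (K d) * norm w)"
    using assms(2) Cauchy_Schwarz_ineq2[of "K d" w] by (simp add: abs_mult mult_left_mono)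
  also have "\<dots> \<le> (\<rho> * onorm K * norm d) * norm w"
    using assms(2) onorm[OF assms(1), of d]
    by (metis mult.assoc mult_left_mono mult_right_mono norm_ge_zero)
  also have "\<dots> \<le> 1 / 2 * (\<rho> * onorm K * norm d)\<^sup>2 + 1 / 2 * (norm w)\<^sup>2"
    using sum_squares_bound[of "\<rho> * onorm K * norm d" "norm w"] by simp
  finally show ?thesis .
qed

lemma linear_imp_convex_on:
  assumes "linear l" "convex C"
  shows "convex_on C l"
  by (rule convex_onI) (use assms in \<open>auto simp: linear_add linear_scale\<close>)

text \<open>Jensen's inequality with normalised weights; \<open>z n\<close> carries
  \<open>\<sigma> (n - 1)\<close>, the step size that produces it.\<close>

lemma ergodic_mean_convex:
  assumes conv: "convex_on C \<phi>" and z: "\<forall>n\<ge>1. z n \<in> C"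
    and \<sigma>: "\<And>n. \<sigma> n > 0" and N: "N \<ge> 1"
  shows "ergodic_mean \<sigma> z N \<in> C"
    and "\<phi> (ergodic_mean \<sigma> z N)
      \<le> (\<Sum>n=1..N. \<sigma> (n - 1) / \<sigma> 0 * \<phi> (z n)) / weight_sum \<sigma> N"
proof -
  define a where "a n = \<sigma> (n - 1) / \<sigma> 0 / weight_sum \<sigma> N" for n
  have W: "weight_sum \<sigma> N > 0"
    unfolding weight_sum_def using N \<sigma> by (intro sum_pos) auto
  have "(\<Sum>n=1..N. a n) = weight_sum \<sigma> N / weight_sum \<sigma> N"
    by (simp only: a_def weight_sum_def sum_divide_distrib)
  then have a: "(\<Sum>n=1..N. a n) = 1" "\<And>n. a n \<ge> 0"
    using W \<sigma> by (auto simp: a_def intro!: divide_nonneg_pos less_imp_le)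
  have mean: "ergodic_mean \<sigma> z N = (\<Sum>n=1..N. a n *\<^sub>R z n)"
    by (simp add: ergodic_mean_def a_def scaleR_sum_right mult.commute)
  show "ergodic_mean \<sigma> z N \<in> C"
    unfolding mean using a z by (intro convex_sum convex_on_imp_convex[OF conv]) auto
  have "\<phi> (ergodic_mean \<sigma> z N) \<le> (\<Sum>n=1..N. a n * \<phi> (z n))"
    unfolding mean using a z N by (intro convex_on_sum[OF _ _ conv]) auto
  then show "\<phi> (ergodic_mean \<sigma> z N)
      \<le> (\<Sum>n=1..N. \<sigma> (n - 1) / \<sigma> 0 * \<phi> (z n)) / weight_sum \<sigma> N"
    by (simp add: a_def sum_divide_distrib)
qed

lemma lagrangian_real:
  assumes "proper f" "proper g" "proper (conjugate h)"
    and "u \<in> edom f" "u \<in> edom g" "w \<in> edom (conjugate h)"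
  shows "lagrangian K f g h u w = ereal (K u \<bullet> w + real_of_ereal (f u) + real_of_ereal (g u)
    - real_of_ereal (conjugate h w))"
  unfolding lagrangian_def
  by (subst proper_ereal[OF assms(1,4)], subst proper_ereal[OF assms(2,5)],
      subst proper_ereal[OF assms(3,6)]) simp

text \<open>The saddle inequalities are compared at points \<open>u\<close> and \<open>w\<close> of
  the domains. The dual component comes first, because its finiteness is what excludes the value
  \<open>\<infinity>\<close> at \<open>(u, ys)\<close>.\<close>

lemma saddle_point_edom:
  assumes proper: "proper f" "proper g" "proper (conjugate h)" and dom: "edom f = UNIV"
    and saddle: "saddle_point (lagrangian K f g h) xs ys"
  shows "xs \<in> edom g" "ys \<in> edom (conjugate h)"
proof -
  obtain u w where u: "u \<in> edom g" and w: "w \<in> edom (conjugate h)"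
    using proper by (auto simp: proper_def)
  note fin_f = proper_ereal[OF proper(1), unfolded dom, OF UNIV_I]
  note fin_u = proper_ereal[OF proper(2) u]
  note fin_w = proper_ereal[OF proper(3) w]
  have le: "lagrangian K f g h xs w \<le> lagrangian K f g h xs ys"
    "lagrangian K f g h xs ys \<le> lagrangian K f g h u ys"
    using saddle unfolding saddle_point_def by blast+
  show "ys \<in> edom (conjugate h)"
  proof (rule ccontr)
    assume "ys \<notin> edom (conjugate h)"
    then have "conjugate h ys = \<infinity>"
      by (simp add: edom_def)
    then have "lagrangian K f g h u ys = - \<infinity>"
      unfolding lagrangian_def by (subst fin_f, subst fin_u) simp
    with le have "lagrangian K f g h xs w = - \<infinity>"
      by simp
    moreover have "g xs \<noteq> - \<infinity>"
      using proper(2) by (simp add: proper_def)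
    then have "lagrangian K f g h xs w \<noteq> - \<infinity>"
      unfolding lagrangian_def by (subst fin_f, subst fin_w) (cases "g xs"; simp)
    ultimately show False
      by simp
  qed
  note fin_ys = proper_ereal[OF proper(3) this]
  show "xs \<in> edom g"
  proof (rule ccontr)
    assume "xs \<notin> edom g"
    then have "g xs = \<infinity>"
      by (simp add: edom_def)
    then have "lagrangian K f g h xs ys = \<infinity>"
      unfolding lagrangian_def by (subst fin_f) simp
    moreover have "lagrangian K f g h u ys \<noteq> \<infinity>"
      unfolding lagrangian_def by (subst fin_f, subst fin_u, subst fin_ys) simp
    ultimately show False
      using le(2) by simp
  qed
qed

text \<open>The extrapolation splits the coupling term into a telescoping part and a remainder, which
  Young's inequality absorbs into the squared increments since \<open>\<sigma> * (onorm K)\<^sup>2 \<le> 1 / \<tau> - M\<close>.\<close>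

lemma primal_dual_energy_step:
  fixes K :: "'a::real_inner \<Rightarrow> 'b::real_inner"
  assumes K: "bounded_linear K" and pos: "\<sigma> > 0" "\<rho> \<ge> 0"
    and extra: "\<sigma> *\<^sub>R (xt - x) = \<rho> *\<^sub>R (x - xp)"
    and step_size: "\<sigma> * (onorm K)\<^sup>2 \<le> 1 / \<tau> - M"
    and step: "gap + (1 / (2 * \<tau>) + \<gamma> / 2) * (norm (xs - x'))\<^sup>2
        + 1 / (2 * \<sigma>) * (norm (ys - y'))\<^sup>2
        + (1 / (2 * \<tau>) - M / 2) * (norm (x' - x))\<^sup>2 + 1 / (2 * \<sigma>) * (norm (y' - y))\<^sup>2
      \<le> 1 / (2 * \<tau>) * (norm (xs - x))\<^sup>2 + 1 / (2 * \<sigma>) * (norm (ys - y))\<^sup>2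
        + K (x' - xt) \<bullet> (ys - y') + err"
  shows "\<sigma> * gap + (\<sigma> * (1 / \<tau> + \<gamma>) / 2 * (norm (xs - x'))\<^sup>2 + 1 / 2 * (norm (ys - y'))\<^sup>2
      - \<sigma> * (K (x' - x) \<bullet> (ys - y')) + 1 / 2 * (\<sigma> * onorm K * norm (x' - x))\<^sup>2)
    \<le> (\<sigma> / \<tau> / 2 * (norm (xs - x))\<^sup>2 + 1 / 2 * (norm (ys - y))\<^sup>2
      - \<rho> * (K (x - xp) \<bullet> (ys - y)) + 1 / 2 * (\<rho> * onorm K * norm (x - xp))\<^sup>2) + \<sigma> * err"
proof -
  interpret K: bounded_linear K by fact
  have "\<sigma> *\<^sub>R K (xt - x) = \<rho> *\<^sub>R K (x - xp)"
    using extra by (metis K.scaleR)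
  then have "\<sigma> * (K (xt - x) \<bullet> (ys - y')) = \<rho> * (K (x - xp) \<bullet> (ys - y'))"
    by (metis inner_scaleR_left)
  moreover have "\<sigma> * (K (x' - xt) \<bullet> (ys - y'))
      = \<sigma> * (K (x' - x) \<bullet> (ys - y')) - \<sigma> * (K (xt - x) \<bullet> (ys - y'))"
    by (simp add: K.diff inner_diff_left right_diff_distrib)
  moreover have "\<rho> * (K (x - xp) \<bullet> (ys - y'))
      = \<rho> * (K (x - xp) \<bullet> (ys - y)) - \<rho> * (K (x - xp) \<bullet> (y' - y))"
    by (simp add: inner_diff_right right_diff_distrib)
  ultimately have coupling: "\<sigma> * (K (x' - xt) \<bullet> (ys - y'))
      = \<sigma> * (K (x' - x) \<bullet> (ys - y')) - \<rho> * (K (x - xp) \<bullet> (ys - y))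
        + \<rho> * (K (x - xp) \<bullet> (y' - y))"
    by linarith
  have young: "\<rho> * (K (x - xp) \<bullet> (y' - y))
      \<le> 1 / 2 * (\<rho> * onorm K * norm (x - xp))\<^sup>2 + 1 / 2 * (norm (y' - y))\<^sup>2"
    using weighted_young[OF K pos(2), of "x - xp" "y' - y"] by linarith
  \<comment> \<open>The squared increment dominates a square that is kept in the energy and pays for
    Young's inequality in the following step.\<close>
  have "\<sigma> * (onorm K)\<^sup>2 * (\<sigma> * (norm (x' - x))\<^sup>2) \<le> (1 / \<tau> - M) * (\<sigma> * (norm (x' - x))\<^sup>2)"
    using step_size pos by (intro mult_right_mono) auto
  then have incr: "1 / 2 * (\<sigma> * onorm K * norm (x' - x))\<^sup>2
      \<le> \<sigma> * ((1 / (2 * \<tau>) - M / 2) * (norm (x' - x))\<^sup>2)"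
    by (simp add: power_mult_distrib power2_eq_square algebra_simps)
  have "\<sigma> * (gap + (1 / (2 * \<tau>) + \<gamma> / 2) * (norm (xs - x'))\<^sup>2
        + 1 / (2 * \<sigma>) * (norm (ys - y'))\<^sup>2
        + (1 / (2 * \<tau>) - M / 2) * (norm (x' - x))\<^sup>2 + 1 / (2 * \<sigma>) * (norm (y' - y))\<^sup>2)
      \<le> \<sigma> * (1 / (2 * \<tau>) * (norm (xs - x))\<^sup>2 + 1 / (2 * \<sigma>) * (norm (ys - y))\<^sup>2
        + K (x' - xt) \<bullet> (ys - y') + err)"
    using step pos by (intro mult_left_mono) auto
  then have "\<sigma> * gap + \<sigma> * (1 / \<tau> + \<gamma>) / 2 * (norm (xs - x'))\<^sup>2 + 1 / 2 * (norm (ys - y'))\<^sup>2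
        + \<sigma> * ((1 / (2 * \<tau>) - M / 2) * (norm (x' - x))\<^sup>2) + 1 / 2 * (norm (y' - y))\<^sup>2
      \<le> \<sigma> / \<tau> / 2 * (norm (xs - x))\<^sup>2 + 1 / 2 * (norm (ys - y))\<^sup>2
        + \<sigma> * (K (x' - xt) \<bullet> (ys - y')) + \<sigma> * err"
    using pos(1) by (simp add: algebra_simps add_divide_distrib)
  then show ?thesis
    using coupling young incr by linarith
qed

section \<open>Step sizes and convergence rates\<close>

text \<open>Collects what follows from the recursion for arbitrary positive initial values; the
  prescribed ones enter later, through the step size condition.\<close>

locale accelerated_steps =
  fixes \<gamma> :: real and \<tau> \<sigma> \<theta> :: "nat \<Rightarrow> real"
  assumes \<gamma>: "\<gamma> > 0" and \<tau>0: "\<tau> 0 > 0" and \<sigma>0: "\<sigma> 0 > 0"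
    and \<theta>: "\<theta> (Suc n) = 1 / sqrt (1 + \<gamma> * \<tau> n)"
    and \<tau>: "\<tau> (Suc n) = \<theta> (Suc n) * \<tau> n"
    and \<sigma>: "\<sigma> (Suc n) = \<sigma> n / \<theta> (Suc n)"
begin

lemma \<tau>_pos: "\<tau> n > 0"
  by (induction n) (use \<gamma> \<tau>0 in \<open>auto simp: \<tau> \<theta> intro!: divide_pos_pos add_pos_pos\<close>)

lemma \<theta>_pos: "\<theta> (Suc n) > 0"
  using \<gamma> \<tau>_pos[of n] by (auto simp: \<theta> intro!: add_pos_pos)

lemma \<sigma>_pos: "\<sigma> n > 0"
  by (induction n) (auto simp: \<sigma> \<sigma>0 \<theta>_pos)

lemma \<sigma>_\<theta>: "\<sigma> (Suc n) * \<theta> (Suc n) = \<sigma> n"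
  using \<theta>_pos[of n] by (simp add: \<sigma>)

lemma \<sigma>_\<tau>: "\<sigma> n * \<tau> n = \<sigma> 0 * \<tau> 0"
proof (induction n)
  case (Suc n)
  then show ?case
    using \<theta>_pos[of n] by (simp add: \<sigma> \<tau>)
qed simp

lemma \<sigma>_eq: "\<sigma> n = \<sigma> 0 * \<tau> 0 * (1 / \<tau> n)"
  using \<sigma>_\<tau>[of n] \<tau>_pos[of n] by (simp add: field_simps)

text \<open>Squaring removes the root from the recursion; both linear growth bounds for
  \<open>1 / \<tau> n\<close> rest on this form.\<close>

lemma inverse_\<tau>_Suc: "(1 / \<tau> (Suc n))\<^sup>2 = (1 / \<tau> n)\<^sup>2 + \<gamma> * (1 / \<tau> n)"
proof -
  have "0 < 1 + \<gamma> * \<tau> n"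
    using \<gamma> \<tau>_pos[of n] by (intro add_pos_pos) auto
  then have "(\<tau> (Suc n))\<^sup>2 = (\<tau> n)\<^sup>2 / (1 + \<gamma> * \<tau> n)"
    by (simp add: \<tau> \<theta> power_divide power_mult_distrib)
  then have "(1 / \<tau> (Suc n))\<^sup>2 = (1 + \<gamma> * \<tau> n) / (\<tau> n)\<^sup>2"
    by (simp add: power_divide)
  then show ?thesis
    using \<tau>_pos[of n] by (simp add: power_divide field_simps power2_eq_square)
qed

text \<open>The reason for this choice of \<open>\<theta>\<close>: the distance weight gained from
  strong convexity is exactly the weight of the next step, so the energy telescopes.\<close>

lemma weight_Suc: "\<sigma> (Suc n) / \<tau> (Suc n) = \<sigma> n * (1 / \<tau> n + \<gamma>)"
proof -
  have "\<sigma> (Suc n) / \<tau> (Suc n) = \<sigma> 0 * \<tau> 0 * (1 / \<tau> (Suc n))\<^sup>2"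
    by (subst \<sigma>_eq) (simp add: power2_eq_square)
  also have "\<dots> = \<sigma> 0 * \<tau> 0 * (1 / \<tau> n) * (1 / \<tau> n + \<gamma>)"
    unfolding inverse_\<tau>_Suc using \<tau>_pos[of n] by (simp add: power2_eq_square field_simps)
  finally show ?thesis
    unfolding \<sigma>_eq[of n] .
qed

text \<open>With \<open>s = 1 / \<tau> n\<close>, the square of \<open>s + \<gamma>\<close> is at
  least \<open>s\<^sup>2 + \<gamma> * s\<close>, so each increment is at most
  \<open>\<gamma>\<close>.\<close>

lemma inverse_\<tau>_le: "1 / \<tau> n \<le> (1 / \<tau> 0 + \<gamma>) * (real n + 1)"
proof -
  have "1 / \<tau> n \<le> 1 / \<tau> 0 + \<gamma> * real n"
  proof (induction n)
    case (Suc n)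
    have "0 \<le> \<gamma> * (1 / \<tau> n)"
      using \<gamma> \<tau>_pos[of n] by simp
    moreover have "(1 / \<tau> n + \<gamma>)\<^sup>2 = (1 / \<tau> n)\<^sup>2 + 2 * (\<gamma> * (1 / \<tau> n)) + \<gamma>\<^sup>2"
      by (simp add: power2_sum)
    ultimately have "(1 / \<tau> (Suc n))\<^sup>2 \<le> (1 / \<tau> n + \<gamma>)\<^sup>2"
      unfolding inverse_\<tau>_Suc using zero_le_power2[of \<gamma>] by linarith
    then have "1 / \<tau> (Suc n) \<le> 1 / \<tau> n + \<gamma>"
      by (rule power2_le_imp_le) (use \<gamma> \<tau>_pos[of n] in simp)
    with Suc show ?case
      by (simp add: algebra_simps)
  qed simp
  also have "\<dots> \<le> (1 / \<tau> 0 + \<gamma>) * (real n + 1)"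
  proof -
    have "0 \<le> 1 / \<tau> 0 * real n"
      using \<tau>0 by simp
    then show ?thesis
      using \<gamma> by (simp only: distrib_left distrib_right mult_1_right)
  qed
  finally show ?thesis .
qed

lemma inverse_\<tau>_ge:
  obtains c where "c > 0" "\<And>n. 1 / \<tau> 0 + c * real n \<le> 1 / \<tau> n" "\<And>n. c * (real n + 1) \<le> 1 / \<tau> n"
proof -
  \<comment> \<open>The bound \<open>\<gamma> / 4\<close> gives
    \<open>c * (2 * s + c) \<le> \<gamma> * s\<close> once \<open>c \<le> s\<close>; the bound
    \<open>1 / \<tau> 0\<close> ensures \<open>c \<le> s\<close> and yields the form with
    \<open>real n + 1\<close>.\<close>
  define c where "c = min (\<gamma> / 4) (1 / \<tau> 0)"
  have c: "0 < c" "c \<le> \<gamma> / 4" "c \<le> 1 / \<tau> 0"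
    using \<gamma> \<tau>0 by (auto simp: c_def)
  have main: "1 / \<tau> 0 + c * real n \<le> 1 / \<tau> n" for n
  proof (induction n)
    case (Suc n)
    define s where "s = 1 / \<tau> n"
    have s: "c \<le> s"
      using Suc c mult_nonneg_nonneg[of c "real n"] unfolding s_def by linarith
    have "(s + c)\<^sup>2 = s\<^sup>2 + c * (2 * s + c)"
      by (simp add: power2_eq_square algebra_simps)
    also have "\<dots> \<le> s\<^sup>2 + \<gamma> / 4 * (4 * s)"
      using s c by (intro add_left_mono mult_mono) auto
    finally have "(s + c)\<^sup>2 \<le> (1 / \<tau> (Suc n))\<^sup>2"
      unfolding inverse_\<tau>_Suc s_def by simp
    then have "s + c \<le> 1 / \<tau> (Suc n)"
      by (rule power2_le_imp_le) (use \<tau>_pos[of "Suc n"] in simp)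
    with Suc show ?case
      by (simp add: s_def algebra_simps)
  qed simp
  show ?thesis
  proof (rule that[OF c(1) main])
    fix n
    show "c * (real n + 1) \<le> 1 / \<tau> n"
      using main[of n] c by (simp add: algebra_simps)
  qed
qed

lemma \<tau>_le: "\<tau> n \<le> \<tau> 0"
proof -
  obtain c where "c > 0" "1 / \<tau> 0 + c * real n \<le> 1 / \<tau> n"
    using inverse_\<tau>_ge by metis
  then have "1 / \<tau> 0 \<le> 1 / \<tau> n"
    by (smt (verit) mult_nonneg_nonneg of_nat_0_le_iff)
  then show ?thesis
    using \<tau>_pos[of n] \<tau>0 by (simp add: field_simps)
qed

end

section \<open>Uniform error constants and growth of power sums\<close>

lemma bigo_bound_from_one:
  fixes a b :: "nat \<Rightarrow> real"
  assumes "a \<in> O(b)" and pos: "\<And>n. n \<ge> 1 \<Longrightarrow> b n > 0"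
  obtains C where "C > 0" "\<And>n. n \<ge> 1 \<Longrightarrow> \<bar>a n\<bar> \<le> C * b n"
proof -
  obtain c where c: "c > 0" "\<forall>\<^sub>F n in sequentially. norm (a n) \<le> c * norm (b n)"
    using assms(1) by (auto elim: landau_o.bigE)
  then obtain N where N: "\<And>n. n \<ge> N \<Longrightarrow> \<bar>a n\<bar> \<le> c * \<bar>b n\<bar>"
    by (auto simp: eventually_sequentially)
  \<comment> \<open>The finitely many indices before \<open>N\<close> are covered by adding their
    ratios to \<open>c\<close>.\<close>
  let ?C = "c + (\<Sum>k<N. \<bar>a k / b k\<bar>)"
  have sum: "0 \<le> (\<Sum>k<N. \<bar>a k / b k\<bar>)"
    by (intro sum_nonneg) auto
  show ?thesis
  proof (rule that[of ?C])
    show "?C > 0"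
      using c(1) sum by linarith
    fix n :: nat assume n: "n \<ge> 1"
    show "\<bar>a n\<bar> \<le> ?C * b n"
    proof (cases "n < N")
      case True
      have "\<bar>a n / b n\<bar> \<le> (\<Sum>k<N. \<bar>a k / b k\<bar>)"
        using True by (intro member_le_sum) auto
      then have "\<bar>a n / b n\<bar> \<le> ?C"
        using c(1) by linarith
      then show ?thesis
        using pos[OF n] by (simp add: abs_divide field_simps)
    next
      case False
      have "\<bar>a n\<bar> \<le> c * b n"
        using N[of n] False pos[OF n] by simp
      also have "\<dots> \<le> ?C * b n"
        using sum pos[OF n] by (intro mult_right_mono) auto
      finally show ?thesis .
    qed
  qed
qed

text \<open>The first \<open>k\<close> summands are each at least
  \<open>real k powr (- \<alpha>)\<close>.\<close>

lemma power_sum_ge: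
  fixes \<alpha> :: real
  assumes "\<alpha> \<ge> 0" "1 \<le> k" "k \<le> N"
  shows "real k powr (1 - \<alpha>) \<le> (\<Sum>j=1..N. real j powr (- \<alpha>))"
proof -
  have "real k powr (1 - \<alpha>) = (\<Sum>j=1..k. real k powr (- \<alpha>))"
    using assms by (simp add: powr_diff powr_minus divide_inverse)
  also have "\<dots> \<le> (\<Sum>j=1..k. real j powr (- \<alpha>))"
    using assms by (intro sum_mono powr_mono2') auto
  also have "\<dots> \<le> (\<Sum>j=1..N. real j powr (- \<alpha>))"
    using assms by (intro sum_mono2) auto
  finally show ?thesis .
qed

text \<open>Each summand splits as
  \<open>real k powr (- \<alpha>) * real k powr (1 - \<alpha>)\<close>, whose second factor is at
  most the power sum. Hence the accumulated second-order errors never exceed the square of the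
  first-order ones.\<close>

lemma power_sum_double:
  fixes \<alpha> :: real
  assumes "\<alpha> \<ge> 0"
  shows "(\<Sum>k=1..N. real k * real k powr (- 2 * \<alpha>)) \<le> (\<Sum>k=1..N. real k powr (- \<alpha>))\<^sup>2"
proof -
  have "real k * real k powr (- 2 * \<alpha>) \<le> real k powr (- \<alpha>) * (\<Sum>j=1..N. real j powr (- \<alpha>))"
    if k: "k \<in> {1..N}" for k
  proof -
    have "real k * real k powr (- 2 * \<alpha>) = real k powr 1 * real k powr (- 2 * \<alpha>)"
      using k by simp
    also have "\<dots> = real k powr (- \<alpha>) * real k powr (1 - \<alpha>)"
      by (simp only: flip: powr_add) simp
    also have "\<dots> \<le> real k powr (- \<alpha>) * (\<Sum>j=1..N. real j powr (- \<alpha>))"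
      using k assms by (intro mult_left_mono power_sum_ge) auto
    finally show ?thesis .
  qed
  then have "(\<Sum>k=1..N. real k * real k powr (- 2 * \<alpha>))
      \<le> (\<Sum>k=1..N. real k powr (- \<alpha>) * (\<Sum>j=1..N. real j powr (- \<alpha>)))"
    by (rule sum_mono)
  then show ?thesis
    by (simp only: power2_eq_square flip: sum_distrib_right)
qed

text \<open>A discrete integral comparison: by the mean value theorem each summand is at most a
  telescoping increment of \<open>real N powr (1 - \<alpha>) / (1 - \<alpha>)\<close>.\<close>

lemma power_sum_le:
  fixes \<alpha> :: real
  assumes "0 < \<alpha>" "\<alpha> < 1"
  shows "(\<Sum>k=1..N. real k powr (- \<alpha>)) \<le> real N powr (1 - \<alpha>) / (1 - \<alpha>)"
proof (induction N)
  case (Suc N)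
  \<comment> \<open>The case \<open>N = 0\<close> is direct, because the power is differentiated
    only at positive points.\<close>
  have "(1 - \<alpha>) * real (Suc N) powr (- \<alpha>) \<le> real (Suc N) powr (1 - \<alpha>) - real N powr (1 - \<alpha>)"
  proof (cases "N = 0")
    case False
    have "\<exists>z>real N. z < real (Suc N) \<and> real (Suc N) powr (1 - \<alpha>) - real N powr (1 - \<alpha>)
        = (real (Suc N) - real N) * ((1 - \<alpha>) * z powr (1 - \<alpha> - 1))"
    proof (rule MVT2)
      fix z assume "real N \<le> z" "z \<le> real (Suc N)"
      with False have "z > 0"
        by linarith
      then show "((\<lambda>z. z powr (1 - \<alpha>)) has_real_derivative (1 - \<alpha>) * z powr (1 - \<alpha> - 1)) (at z)"
        by (auto intro!: derivative_eq_intros)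
    qed simp
    then obtain z where z: "z > real N" "z < real (Suc N)"
      "real (Suc N) powr (1 - \<alpha>) - real N powr (1 - \<alpha>) = (1 - \<alpha>) * z powr (- \<alpha>)"
      by auto
    have "real (Suc N) powr (- \<alpha>) \<le> z powr (- \<alpha>)"
      using z assms by (intro powr_mono2') auto
    then show ?thesis
      using z(3) assms by simp
  qed (use assms in simp)
  then have "real (Suc N) powr (- \<alpha>) \<le> (real (Suc N) powr (1 - \<alpha>) - real N powr (1 - \<alpha>)) / (1 - \<alpha>)"
    using assms by (simp add: field_simps)
  with Suc show ?case
    by (simp add: diff_divide_distrib)
qed simp

text \<open>The three rates are the growth regimes of the power sum: bounded, logarithmic, and of
  order \<open>real N powr (1 - \<alpha>)\<close>.\<close>

lemma power_sum_rate:
  fixes \<alpha> :: real and v :: "nat \<Rightarrow> real"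
  assumes \<alpha>: "\<alpha> > 0"
    and v: "\<And>N. N \<ge> 1 \<Longrightarrow> \<bar>v N\<bar> \<le> C * (\<Sum>k=1..N. real k powr (- \<alpha>))\<^sup>2 / (real N)\<^sup>2"
  shows "v \<in> O(\<lambda>N. if \<alpha> > 1 then 1 / (real N)\<^sup>2
         else if \<alpha> = 1 then (ln (real N))\<^sup>2 / (real N)\<^sup>2
         else real N powr (- 2 * \<alpha>))"
    (is "_ \<in> O(?rate)")
proof -
  define P where "P N = (\<Sum>k=1..N. real k powr (- \<alpha>))" for N :: nat
  have P_nonneg: "P N \<ge> 0" for N
    unfolding P_def by (intro sum_nonneg) simp
  have C: "C \<ge> 0"
    using v[of 1] by simp
  have "\<exists>B\<ge>0. \<forall>\<^sub>F N in sequentially. (P N)\<^sup>2 / (real N)\<^sup>2 \<le> B * ?rate N"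
  proof -
    consider "\<alpha> > 1" | "\<alpha> = 1" | "\<alpha> < 1"
      by linarith
    then show ?thesis
    proof cases
      case 1
      then have sum: "summable (\<lambda>k. real k powr (- \<alpha>))"
        by (simp add: summable_real_powr_iff)
      have "P N \<le> (\<Sum>k. real k powr (- \<alpha>))" for N
        unfolding P_def using sum by (intro sum_le_suminf) auto
      then have "(P N)\<^sup>2 / (real N)\<^sup>2 \<le> (\<Sum>k. real k powr (- \<alpha>))\<^sup>2 * ?rate N" for N
        using 1 P_nonneg[of N] by (simp add: divide_right_mono power_mono)
      then show ?thesis
        by (intro exI[of _ "(\<Sum>k. real k powr (- \<alpha>))\<^sup>2"]) auto
    next
      case 2
      have harm: "P N = harm N" for N
        unfolding P_def harm_def using 2 by (intro sum.cong) (auto simp: powr_minus)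
      \<comment> \<open>From such \<open>N\<close> on, the 1 in
        \<open>harm N \<le> ln (real N) + 1\<close> is absorbed by a second logarithm.\<close>
      have "\<forall>\<^sub>F N in sequentially. 1 \<le> ln (real N)"
        using filterlim_compose[OF ln_at_top filterlim_real_sequentially]
        by (simp add: filterlim_at_top)
      then have "\<forall>\<^sub>F N in sequentially. (P N)\<^sup>2 / (real N)\<^sup>2 \<le> 4 * ?rate N"
        using eventually_gt_at_top[of 0]
      proof eventually_elim
        case (elim N)
        obtain m where "N = Suc m"
          using elim(2) gr0_implies_Suc by blast
        then have "harm N - ln (real N) \<le> (1 :: real)"
          using decseqD[OF decseq_harm_diff_ln, of 0 m] by (simp add: harm_def)
        then have "P N \<le> 2 * ln (real N)"
          using elim(1) by (simp add: harm)
        then have "(P N)\<^sup>2 \<le> 4 * (ln (real N))\<^sup>2"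
          using power_mono[of "P N" "2 * ln (real N)" 2] P_nonneg[of N] by (simp add: power_mult_distrib)
        then show ?case
          using 2 by (simp add: divide_right_mono)
      qed
      then show ?thesis
        by (intro exI[of _ 4]) auto
    next
      case 3
      have "(P N)\<^sup>2 / (real N)\<^sup>2 \<le> (1 / (1 - \<alpha>))\<^sup>2 * ?rate N" if N: "N > 0" for N
      proof -
        have "(P N)\<^sup>2 \<le> (real N powr (1 - \<alpha>) / (1 - \<alpha>))\<^sup>2"
          unfolding P_def using power_sum_le[OF \<alpha> 3] P_nonneg[of N, unfolded P_def]
          by (rule power_mono)
        also have "\<dots> = (1 / (1 - \<alpha>))\<^sup>2 * (real N powr (1 - \<alpha>))\<^sup>2"
          by (simp add: power_divide)
        also have "(real N powr (1 - \<alpha>))\<^sup>2 = real N powr (2 + - 2 * \<alpha>)"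
          by (simp add: power2_eq_square flip: powr_add)
        also have "\<dots> = (real N)\<^sup>2 * real N powr (- 2 * \<alpha>)"
          using N by (subst powr_add) (simp add: powr_numeral)
        finally show ?thesis
          using N 3 by (simp add: field_simps)
      qed
      then have "\<forall>\<^sub>F N in sequentially. (P N)\<^sup>2 / (real N)\<^sup>2 \<le> (1 / (1 - \<alpha>))\<^sup>2 * ?rate N"
        by (intro eventually_mono[OF eventually_gt_at_top[of 0]])
      then show ?thesis
        by (intro exI[of _ "(1 / (1 - \<alpha>))\<^sup>2"]) auto
    qed
  qed
  then obtain B where B: "B \<ge> 0" "\<forall>\<^sub>F N in sequentially. (P N)\<^sup>2 / (real N)\<^sup>2 \<le> B * ?rate N"
    by blast
  show ?thesis
  proof (rule bigoI[of _ "C * B"])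
    show "\<forall>\<^sub>F N in sequentially. norm (v N) \<le> C * B * norm (?rate N)"
      using B(2) eventually_ge_at_top[of 1]
    proof eventually_elim
      case (elim N)
      have "norm (v N) \<le> C * ((P N)\<^sup>2 / (real N)\<^sup>2)"
        using v[OF elim(2)] by (simp add: P_def)
      also have "\<dots> \<le> C * (B * ?rate N)"
        by (rule mult_left_mono[OF elim(1) C])
      also have "\<dots> \<le> C * (B * norm (?rate N))"
        using B(1) C by (intro mult_left_mono) auto
      finally show ?case
        by simp
    qed
  qed
qed

text \<open>A linear perturbation of a quadratic energy is absorbed by evaluating the estimate at the index
  where \<open>u\<close> is largest.\<close>

lemma linear_perturbation_bound:
  fixes S u p P :: "nat \<Rightarrow> real"
  assumes c: "c > 0" and B: "B \<ge> 0" and \<Lambda>: "\<Lambda> \<ge> 0"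
    and S: "\<And>N. S N \<ge> 0" and u: "\<And>k. u k \<ge> 0" and p: "\<And>k. p k \<ge> 0"
    and P: "\<And>N. P N = (\<Sum>k=1..N. p k)"
    and est: "\<And>N. N \<ge> 1 \<Longrightarrow> S N + c * (u N)\<^sup>2 \<le> B * (P N)\<^sup>2 + \<Lambda> * (\<Sum>k=1..N. p k * u k)"
    and N: "N \<ge> 1"
  shows "S N \<le> (B + \<Lambda> * (1 + (B + \<Lambda>) / c)) * (P N)\<^sup>2"
proof -
  define M where "M = Max (u ` {1..N})"
  have "M \<in> u ` {1..N}"
    unfolding M_def using N by (intro Max_in) auto
  then obtain m where m: "m \<ge> 1" "m \<le> N" "u m = M"
    by auto
  have M: "u k \<le> M" if "1 \<le> k" "k \<le> N" for k
    unfolding M_def using that by (intro Max_ge) auto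
  have M0: "M \<ge> 0"
    using u m by blast
  have P0: "P k \<ge> 0" for k
    unfolding P by (intro sum_nonneg p)
  have mono: "P k \<le> P N" if "k \<le> N" for k
    unfolding P using that p by (intro sum_mono2) auto
  have lin: "\<Lambda> * (\<Sum>j=1..k. p j * u j) \<le> \<Lambda> * (P N * M)" if "k \<le> N" for k
  proof -
    have "(\<Sum>j=1..k. p j * u j) \<le> (\<Sum>j=1..k. p j * M)"
      using that p M by (intro sum_mono mult_left_mono) auto
    also have "\<dots> = P k * M"
      by (simp add: P sum_distrib_right)
    also have "\<dots> \<le> P N * M"
      using mono[OF that] M0 by (rule mult_right_mono)
    finally show ?thesis
      using \<Lambda> by (rule mult_left_mono)
  qed
  have "c * M\<^sup>2 \<le> B * (P m)\<^sup>2 + \<Lambda> * (\<Sum>k=1..m. p k * u k)"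
    using est[OF m(1)] S[of m] unfolding m(3) by linarith
  also have "\<dots> \<le> B * (P N)\<^sup>2 + \<Lambda> * (P N * M)"
    by (rule add_mono[OF mult_left_mono[OF power_mono[OF mono[OF m(2)] P0] B] lin[OF m(2)]])
  finally have quad: "c * M\<^sup>2 \<le> B * (P N)\<^sup>2 + \<Lambda> * (P N * M)" .
  \<comment> \<open>Either \<open>M\<close> is at most \<open>P N\<close>, or one factor
    \<open>P N\<close> in the \<open>B\<close> term of \<open>quad\<close> may be replaced by
    \<open>M\<close> and the inequality divided by \<open>M\<close>.\<close>
  have "M \<le> (1 + (B + \<Lambda>) / c) * P N"
  proof (cases "M \<le> P N")
    case True
    have "0 \<le> (B + \<Lambda>) / c * P N"
      using B \<Lambda> c P0 by simp
    with True show ?thesis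
      by (simp add: algebra_simps)
  next
    case False
    then have "B * (P N)\<^sup>2 \<le> B * (P N * M)"
      using B P0[of N] unfolding power2_eq_square by (intro mult_left_mono) auto
    with quad have "M * (c * M) \<le> M * ((B + \<Lambda>) * P N)"
      by (simp add: power2_eq_square algebra_simps)
    moreover have "M > 0"
      using False P0[of N] by linarith
    ultimately have "c * M \<le> (B + \<Lambda>) * P N"
      by simp
    then have "M \<le> (B + \<Lambda>) / c * P N"
      using c by (simp add: field_simps)
    with P0[of N] show ?thesis
      by (simp add: algebra_simps)
  qed
  then have "\<Lambda> * (P N * M) \<le> \<Lambda> * (P N * ((1 + (B + \<Lambda>) / c) * P N))"
    using \<Lambda> P0 by (intro mult_left_mono)
  moreover have "S N \<le> B * (P N)\<^sup>2 + \<Lambda> * (P N * M)"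
    using est[OF N] lin[OF order_refl] mult_nonneg_nonneg[OF less_imp_le[OF c] zero_le_power2[of "u N"]]
    by linarith
  ultimately show ?thesis
    by (simp add: power2_eq_square algebra_simps)
qed

section \<open>Ergodic convergence\<close>

theorem corollary3p12:
  fixes K :: "'a::{real_inner,complete_space} \<Rightarrow> 'b::{real_inner,complete_space}"
    and f g :: "'a \<Rightarrow> ereal" and h :: "'b \<Rightarrow> ereal"
    and L Lf \<gamma> \<alpha> :: real
    and \<tau> \<sigma> \<theta> \<epsilon> \<delta> :: "nat \<Rightarrow> real"
    and i :: nat
    and x e :: "nat \<Rightarrow> 'a" and y :: "nat \<Rightarrow> 'b"
    and xs :: 'a and ys :: 'b
  assumes K: "bounded_linear K"
    and f: "proper_convex_lsc f" "differentiable_on_edom f"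
    and f_lipschitz:
      "\<forall>u\<in>edom f. \<forall>u'\<in>edom f. norm (egradient f u - egradient f u') \<le> Lf * norm (u - u')"
    and g: "proper_convex_lsc g"
    and h: "proper_convex_lsc h"
    and strong: "\<gamma> > 0" "strongly_convex \<gamma> g"
    and Lf: "Lf > 0"
    and L: "L = onorm K" "L > 0"
    and init: "\<tau> 0 = 1 / (2 * Lf)" "\<sigma> 0 = Lf / L\<^sup>2"
    and \<theta>: "\<forall>n. \<theta> (Suc n) = 1 / sqrt (1 + \<gamma> * \<tau> n)"
    and \<tau>: "\<forall>n. \<tau> (Suc n) = \<theta> (Suc n) * \<tau> n"
    and \<sigma>: "\<forall>n. \<sigma> (Suc n) = \<sigma> n / \<theta> (Suc n)"
    and i: "i \<in> {1, 2, 3}"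
    and errors_nonneg: "\<forall>n\<ge>1. \<epsilon> n \<ge> 0" "\<forall>n\<ge>1. \<delta> n \<ge> 0"
    and y_step: "\<forall>n. approx_prox2 (\<delta> (Suc n)) (\<sigma> n) (conjugate h)
      (y n + \<sigma> n *\<^sub>R K (extrapolation \<theta> x n)) (y (Suc n))"
    and x_step: "\<forall>n. approx_prox i (\<epsilon> (Suc n)) (\<tau> n) g
      (x n - \<tau> n *\<^sub>R (adjoint K (y (Suc n)) + egradient f (x n) + e (Suc n))) (x (Suc n))"
    and \<alpha>: "\<alpha> > 0"
    and e_rate: "(\<lambda>n. norm (e n)) \<in> O(\<lambda>n. real n powr (- \<alpha>))"
    and \<delta>_rate: "\<delta> \<in> O(\<lambda>n. real n powr (- 2 * \<alpha>))"
    and \<epsilon>_rate: "\<epsilon> \<in> O(\<lambda>n. if i = 2 then real n powr (- 2 * \<alpha>) else real n powr (- (1 + 2 * \<alpha>)))"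
    and saddle: "saddle_point (lagrangian K f g h) xs ys"
  shows "ereal_bigo
    (\<lambda>N. lagrangian K f g h (ergodic_mean \<sigma> x N) ys - lagrangian K f g h xs (ergodic_mean \<sigma> y N))
    (\<lambda>N. if \<alpha> > 1 then 1 / (real N)\<^sup>2
         else if \<alpha> = 1 then (ln (real N))\<^sup>2 / (real N)\<^sup>2
         else real N powr (- 2 * \<alpha>))"
proof -

  \<comment> \<open>Reduction to real-valued convex functions\<close>
  interpret K: bounded_linear K by fact
  note pf = proper_convex_lscD[OF f(1)] and pg = proper_convex_lscD[OF g]
  define hc where "hc = conjugate h"
  have ph: "proper hc" "econvex hc"
    unfolding hc_def using proper_conjugate[OF h] econvex_conjugate proper_convex_lscD(1)[OF h] by auto
  have dom: "edom f = UNIV"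
    by (rule edom_eq_UNIV[OF f, of Lf]) (use f_lipschitz in blast)
  define F G H where "F u = real_of_ereal (f u)" and "G u = real_of_ereal (g u)"
    and "H w = real_of_ereal (hc w)" for u w
  have conv: "convex_on UNIV F" "convex_on (edom g) G" "convex_on (edom hc) H"
    using convex_on_edom[OF pf(1,2)] convex_on_edom[OF pg(1,2)] convex_on_edom[OF ph] dom
    by (simp_all add: F_def[abs_def] G_def[abs_def] H_def[abs_def])
  have grad: "GDERIV F u :> egradient f u" for u
    unfolding F_def[abs_def] using has_egradient_egradient[OF f(2)] dom by (simp add: has_egradient_def)
  have f_upper: "F u' \<le> F u + egradient f u \<bullet> (u' - u) + Lf / 2 * (norm (u' - u))\<^sup>2" for u u'
    by (rule descent_lemma[OF grad]) (use f_lipschitz dom in auto)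
  have f_lower: "F u + egradient f u \<bullet> (u' - u) \<le> F u'" for u u'
    by (rule convex_on_above_tangent_GDERIV[OF conv(1) UNIV_I UNIV_I grad])
  have sdom: "xs \<in> edom g" "ys \<in> edom hc"
    using saddle_point_edom[OF pf(1) pg(1) _ dom saddle] ph(1) by (auto simp: hc_def)
  have lag: "lagrangian K f g h u w = ereal (K u \<bullet> w + F u + G u - H w)"
    if "u \<in> edom g" "w \<in> edom hc" for u w
    unfolding F_def G_def H_def hc_def
    by (rule lagrangian_real) (use pf pg ph dom that in \<open>auto simp: hc_def\<close>)
  define gap where "gap u w = (K u \<bullet> ys + F u + G u - H ys) - (K xs \<bullet> w + F xs + G xs - H w)" for u w
  have lag_gap: "lagrangian K f g h u ys - lagrangian K f g h xs w = ereal (gap u w)"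
    if "u \<in> edom g" "w \<in> edom hc" for u w
    using that sdom by (simp add: lag gap_def)
  have gap_nonneg: "0 \<le> gap u w" if "u \<in> edom g" "w \<in> edom hc" for u w
  proof -
    have "lagrangian K f g h xs w \<le> lagrangian K f g h u ys"
      using saddle unfolding saddle_point_def by (meson order_trans)
    then show ?thesis
      using that sdom by (simp add: lag gap_def)
  qed

  \<comment> \<open>Energy inequality along the iterates\<close>
  interpret accelerated_steps \<gamma> \<tau> \<sigma> \<theta>
    by unfold_locales (use strong Lf L init \<theta> \<tau> \<sigma> in auto)
  define \<kappa> where "\<kappa> = \<sigma> 0 * \<tau> 0"
  have \<kappa>: "\<kappa> > 0" "\<kappa> = 1 / (2 * L\<^sup>2)" and \<sigma>_\<kappa>: "\<And>n. \<sigma> n = \<kappa> * (1 / \<tau> n)"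
    using Lf L \<sigma>_eq by (auto simp: \<kappa>_def init)

  define \<eta> where "\<eta> n = 2 * sqrt (\<epsilon> n * (if i = 2 then \<gamma> else \<gamma> + 1 / \<tau> (n - 1)))" for n
  have x_dom: "x (Suc n) \<in> edom g"
    and x_ineq: "G (x (Suc n)) + (x n - \<tau> n *\<^sub>R (adjoint K (y (Suc n)) + egradient f (x n) + e (Suc n))
        - x (Suc n)) \<bullet> (xs - x (Suc n)) / \<tau> n + \<gamma> / 2 * (norm (xs - x (Suc n)))\<^sup>2
      - \<eta> (Suc n) * norm (xs - x (Suc n)) - \<epsilon> (Suc n) \<le> G xs" for n
    using approx_prox_inequality[OF g strong(2,1) \<tau>_pos _ x_step[rule_format, of n] sdom(1)]
      errors_nonneg(1) unfolding G_def \<eta>_def by auto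
  have y_dom: "y (Suc n) \<in> edom hc"
    and y_ineq: "H (y (Suc n)) + (1 / \<sigma> n) *\<^sub>R (y n + \<sigma> n *\<^sub>R K (extrapolation \<theta> x n) - y (Suc n))
        \<bullet> (ys - y (Suc n)) - \<delta> (Suc n) \<le> H ys" for n
    using eps_subdiffD[OF ph(1) y_step[rule_format, of n, unfolded approx_prox2_def, folded hc_def]] sdom(2)
    unfolding H_def by auto

  \<comment> \<open>At \<open>n = 0\<close> truncated subtraction gives \<open>\<sigma> 0\<close>;
    this is harmless, since \<open>\<rho> 0\<close> only multiplies the increment
    \<open>x 0 - x (0 - 1) = 0\<close>.\<close>
  define \<rho> where "\<rho> n = \<sigma> (n - 1)" for n
  define V where "V n = \<sigma> n / \<tau> n / 2 * (norm (xs - x n))\<^sup>2 + 1 / 2 * (norm (ys - y n))\<^sup>2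
      - \<rho> n * (K (x n - x (n - 1)) \<bullet> (ys - y n))
      + 1 / 2 * (\<rho> n * onorm K * norm (x n - x (n - 1)))\<^sup>2" for n
  define err where "err n = (norm (e n) + \<eta> n) * norm (xs - x n) + (\<epsilon> n + \<delta> n)" for n
  have energy: "\<sigma> n * gap (x (Suc n)) (y (Suc n)) + V (Suc n) \<le> V n + \<sigma> n * err (Suc n)" for n
  proof -
    \<comment> \<open>For positive \<open>n\<close> this is \<open>\<sigma>_\<theta>\<close>; for
      \<open>n = 0\<close> both sides vanish whatever \<open>\<theta> 0\<close> is.\<close>
    have extra: "\<sigma> n *\<^sub>R (extrapolation \<theta> x n - x n) = \<rho> n *\<^sub>R (x n - x (n - 1))"
      using \<sigma>_\<theta> by (cases n) (auto simp: extrapolation_def \<rho>_def)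
    \<comment> \<open>The initial values split \<open>1 / \<tau> n\<close> in half: one half equals
      the coupling constant, and the other dominates \<open>Lf\<close> because \<open>\<tau>\<close>
      never exceeds \<open>\<tau> 0\<close>.\<close>
    have "\<sigma> n * (onorm K)\<^sup>2 = 1 / (2 * \<tau> n)"
      unfolding \<sigma>_\<kappa> \<kappa>(2) L(1)[symmetric] using L(2) by simp
    also have "\<dots> \<le> 1 / \<tau> n - Lf"
    proof -
      have "1 / \<tau> 0 \<le> 1 / \<tau> n"
        using \<tau>_le[of n] \<tau>_pos[of n] by (intro divide_left_mono mult_pos_pos) (auto simp: \<tau>0)
      then have "2 * Lf \<le> 1 / \<tau> n"
        using Lf by (simp add: init)
      then show ?thesis
        using \<tau>_pos[of n] by (simp add: field_simps)
    qed
    finally have size: "\<sigma> n * (onorm K)\<^sup>2 \<le> 1 / \<tau> n - Lf" .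
    note step = primal_dual_step[OF K.linear_axioms hilbert_adjoint[OF K] \<tau>_pos \<sigma>_pos
        x_ineq y_ineq f_upper f_lower, folded gap_def, folded err_def]
    have "\<rho> n \<ge> 0"
      using \<sigma>_pos by (simp add: \<rho>_def less_imp_le)
    from primal_dual_energy_step[OF K \<sigma>_pos this extra size step]
    show ?thesis
      unfolding V_def weight_Suc by (simp add: \<rho>_def)
  qed
  define S where "S N = (\<Sum>k=1..N. \<sigma> (k - 1) * gap (x k) (y k))" for N
  have telescope: "S N + V N \<le> V 0 + (\<Sum>k=1..N. \<sigma> (k - 1) * err k)" for N
  proof (induction N)
    case (Suc N)
    then show ?case
      using energy[of N] by (simp add: S_def)
  qed (simp add: S_def)
  \<comment> \<open>The dual square and the stored increment together dominate the coupling term,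
    leaving the primal distance.\<close>
  have V_ge: "\<sigma> N / \<tau> N / 2 * (norm (xs - x N))\<^sup>2 \<le> V N" for N
    using weighted_young[OF K, of "\<rho> N" "x N - x (N - 1)" "ys - y N"] \<sigma>_pos
    by (auto simp: V_def \<rho>_def less_imp_le abs_le_iff)
  have V0: "V 0 \<ge> 0"
    using V_ge[of 0] \<sigma>_pos[of 0] \<tau>_pos[of 0] by (smt (verit) divide_nonneg_nonneg mult_nonneg_nonneg zero_le_power2)

  \<comment> \<open>Growth of the step sizes and decay of the errors\<close>
  define P where "P N = (\<Sum>k=1..N. real k powr (- \<alpha>))" for N
  define q where "q = 1 / \<tau> 0 + \<gamma>"
  have q: "q > 0" "\<gamma> \<le> q"
    using strong \<tau>0 by (auto simp: q_def add_pos_pos)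
  have s_le: "1 / \<tau> (k - 1) \<le> q * real k" if "k \<ge> 1" for k
    using inverse_\<tau>_le[of "k - 1"] that by (simp add: q_def of_nat_diff)
  obtain c where c: "c > 0" "\<And>n. c * (real n + 1) \<le> 1 / \<tau> n"
    using inverse_\<tau>_ge by metis
  have powr_pos: "\<And>n. n \<ge> 1 \<Longrightarrow> real n powr a > 0" for a
    by simp
  obtain Ce where Ce: "Ce > 0" "\<And>n. n \<ge> 1 \<Longrightarrow> norm (e n) \<le> Ce * real n powr (- \<alpha>)"
    using bigo_bound_from_one[OF e_rate powr_pos] by (metis abs_norm_cancel)
  obtain C\<delta> where C\<delta>: "C\<delta> > 0" "\<And>n. n \<ge> 1 \<Longrightarrow> \<bar>\<delta> n\<bar> \<le> C\<delta> * real n powr (- 2 * \<alpha>)"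
    using bigo_bound_from_one[OF \<delta>_rate powr_pos] by metis
  have "0 < (if i = 2 then real n powr (- 2 * \<alpha>) else real n powr (- (1 + 2 * \<alpha>)))" if "n \<ge> 1" for n
    using powr_pos[OF that] by simp
  from bigo_bound_from_one[OF \<epsilon>_rate this]
  obtain C\<epsilon> where C\<epsilon>: "C\<epsilon> > 0" "\<And>n. n \<ge> 1 \<Longrightarrow> \<bar>\<epsilon> n\<bar>
      \<le> C\<epsilon> * (if i = 2 then real n powr (- 2 * \<alpha>) else real n powr (- (1 + 2 * \<alpha>)))"
    by metis
  have \<epsilon>_le: "\<epsilon> n \<le> C\<epsilon> * real n powr (- 2 * \<alpha>)"
    and \<eta>_le: "\<eta> n \<le> 2 * sqrt (C\<epsilon> * (2 * q)) * real n powr (- \<alpha>)" if n: "n \<ge> 1" for n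
  proof -
    let ?m = "if i = 2 then \<gamma> else \<gamma> + 1 / \<tau> (n - 1)"
    have drop: "real n powr (- (1 + 2 * \<alpha>)) \<le> real n powr (- 2 * \<alpha>)"
      using n by (intro powr_mono) auto
    have "\<epsilon> n \<le> C\<epsilon> * (if i = 2 then real n powr (- 2 * \<alpha>) else real n powr (- (1 + 2 * \<alpha>)))"
      using C\<epsilon>(2)[OF n] by linarith
    also have "\<dots> \<le> C\<epsilon> * real n powr (- 2 * \<alpha>)"
      using C\<epsilon>(1) drop by (intro mult_left_mono) auto
    finally show \<epsilon>_le: "\<epsilon> n \<le> C\<epsilon> * real n powr (- 2 * \<alpha>)" .
    \<comment> \<open>For types 1 and 3 the linear growth of \<open>?m\<close> uses up the extra
      power in the rate of \<open>\<epsilon>\<close>, so all types arrive at the same bound.\<close>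
    have "\<epsilon> n * ?m \<le> C\<epsilon> * (2 * q) * real n powr (- 2 * \<alpha>)"
    proof (cases "i = 2")
      case True
      have "\<epsilon> n * \<gamma> \<le> (C\<epsilon> * real n powr (- 2 * \<alpha>)) * (2 * q)"
        using \<epsilon>_le q strong C\<epsilon> by (intro mult_mono) auto
      then show ?thesis
        using True by (simp add: algebra_simps)
    next
      case False
      have "\<gamma> \<le> q * real n"
        using q n mult_mono[of \<gamma> q 1 "real n"] strong(1) by simp
      then have "\<gamma> + 1 / \<tau> (n - 1) \<le> 2 * q * real n"
        using s_le[OF n] by simp
      then have "\<epsilon> n * (\<gamma> + 1 / \<tau> (n - 1)) \<le> (C\<epsilon> * real n powr (- (1 + 2 * \<alpha>))) * (2 * q * real n)"
        using C\<epsilon>(2)[OF n] C\<epsilon>(1) False errors_nonneg(1) n strong(1) \<tau>_pos[of "n - 1"]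
        by (intro mult_mono) auto
      also have "\<dots> = C\<epsilon> * (2 * q) * (real n powr (- (1 + 2 * \<alpha>)) * real n powr 1)"
        using n by simp
      also have "real n powr (- (1 + 2 * \<alpha>)) * real n powr 1 = real n powr (- 2 * \<alpha>)"
        by (simp only: flip: powr_add) simp
      finally show ?thesis
        using False by simp
    qed
    also have "real n powr (- 2 * \<alpha>) = (real n powr (- \<alpha>))\<^sup>2"
      by (simp add: power2_eq_square flip: powr_add)
    finally have "sqrt (\<epsilon> n * ?m) \<le> sqrt (C\<epsilon> * (2 * q) * (real n powr (- \<alpha>))\<^sup>2)"
      by (rule real_sqrt_le_mono)
    then show "\<eta> n \<le> 2 * sqrt (C\<epsilon> * (2 * q)) * real n powr (- \<alpha>)"
      by (simp add: \<eta>_def real_sqrt_mult)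
  qed
  define CE where "CE = Ce + 2 * sqrt (C\<epsilon> * (2 * q))"
  define CA where "CA = C\<epsilon> + C\<delta>"
  have CE: "CE \<ge> 0" and CA: "CA \<ge> 0"
    using Ce(1) C\<epsilon>(1) C\<delta>(1) q by (auto simp: CE_def CA_def)
  define \<Lambda> B where "\<Lambda> = \<kappa> * q * CE" and "B = V 0 + \<kappa> * q * CA"
  \<comment> \<open>The constant delivered by \<open>linear_perturbation_bound\<close>, whose
    quadratic coefficient is here \<open>\<kappa> * c\<^sup>2 / 2\<close>.\<close>
  define C where "C = B + \<Lambda> * (1 + (B + \<Lambda>) / (\<kappa> * c\<^sup>2 / 2))"
  \<comment> \<open>The linear growth of \<open>\<sigma>\<close> is attached to the distance, so
    that \<open>real k * norm (xs - x k)\<close> becomes the quantity to be bounded.\<close>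
  have err_le: "\<sigma> (k - 1) * err k \<le> \<Lambda> * (real k powr (- \<alpha>) * (real k * norm (xs - x k)))
      + \<kappa> * q * CA * (real k * real k powr (- 2 * \<alpha>))" if k: "k \<ge> 1" for k
  proof -
    have "norm (e k) + \<eta> k \<le> CE * real k powr (- \<alpha>)"
      using Ce(2)[OF k] \<eta>_le[OF k] by (simp add: CE_def algebra_simps)
    moreover have "\<epsilon> k + \<delta> k \<le> CA * real k powr (- 2 * \<alpha>)"
      using \<epsilon>_le[OF k] C\<delta>(2)[OF k] by (simp add: CA_def algebra_simps)
    ultimately have "err k \<le> CE * real k powr (- \<alpha>) * norm (xs - x k) + CA * real k powr (- 2 * \<alpha>)"
      unfolding err_def by (intro add_mono mult_right_mono) auto
    moreover have "\<sigma> (k - 1) \<le> \<kappa> * (q * real k)"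
      unfolding \<sigma>_\<kappa> using s_le[OF k] \<kappa>(1) by (intro mult_left_mono) auto
    moreover have "0 \<le> CE * real k powr (- \<alpha>) * norm (xs - x k) + CA * real k powr (- 2 * \<alpha>)"
      using CE CA by simp
    ultimately have "\<sigma> (k - 1) * err k
        \<le> \<kappa> * (q * real k) * (CE * real k powr (- \<alpha>) * norm (xs - x k) + CA * real k powr (- 2 * \<alpha>))"
      using \<sigma>_pos[of "k - 1"] by (meson less_imp_le mult_left_mono mult_right_mono order_trans)
    then show ?thesis
      by (simp add: \<Lambda>_def algebra_simps)
  qed
  have S_le: "S N \<le> C * (P N)\<^sup>2" if N: "N \<ge> 1" for N
    unfolding C_def
  proof (rule linear_perturbation_bound[where u = "\<lambda>k. real k * norm (xs - x k)", OF _ _ _ _ _ _ P_def _ N])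
    fix N :: nat assume N: "N \<ge> 1"
    have "(\<Sum>k=1..N. \<sigma> (k - 1) * err k)
        \<le> (\<Sum>k=1..N. \<Lambda> * (real k powr (- \<alpha>) * (real k * norm (xs - x k)))
          + \<kappa> * q * CA * (real k * real k powr (- 2 * \<alpha>)))"
      by (intro sum_mono err_le) simp
    also have "\<dots> = \<Lambda> * (\<Sum>k=1..N. real k powr (- \<alpha>) * (real k * norm (xs - x k)))
        + \<kappa> * q * CA * (\<Sum>k=1..N. real k * real k powr (- 2 * \<alpha>))"
      by (simp only: sum.distrib sum_distrib_left)
    also have "\<dots> \<le> \<Lambda> * (\<Sum>k=1..N. real k powr (- \<alpha>) * (real k * norm (xs - x k)))
        + \<kappa> * q * CA * (P N)\<^sup>2"
      unfolding P_def using \<alpha> \<kappa>(1) q CA by (intro add_left_mono mult_left_mono power_sum_double) auto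
    finally have "(\<Sum>k=1..N. \<sigma> (k - 1) * err k)
      \<le> \<Lambda> * (\<Sum>k=1..N. real k powr (- \<alpha>) * (real k * norm (xs - x k))) + \<kappa> * q * CA * (P N)\<^sup>2" .
    \<comment> \<open>This lets the constant \<open>V 0\<close> be counted as a multiple of
      \<open>(P N)\<^sup>2\<close>.\<close>
    moreover have "1 \<le> P N"
      using power_sum_ge[of \<alpha> 1 N] \<alpha> N by (simp add: P_def)
    then have "V 0 \<le> V 0 * (P N)\<^sup>2"
      using V0 by (simp add: mult_le_cancel_left1 one_le_power)
    moreover have "\<kappa> * c\<^sup>2 / 2 * (real N * norm (xs - x N))\<^sup>2 \<le> V N"
    proof -
      have "c * real N \<le> 1 / \<tau> N"
        using c(2)[of N] c(1) by (simp add: algebra_simps)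
      then have "(c * real N)\<^sup>2 \<le> (1 / \<tau> N)\<^sup>2"
        using c(1) by (intro power_mono) auto
      then have "\<kappa> * (c * real N)\<^sup>2 / 2 * (norm (xs - x N))\<^sup>2 \<le> \<kappa> * (1 / \<tau> N)\<^sup>2 / 2 * (norm (xs - x N))\<^sup>2"
        using \<kappa>(1) by (intro mult_right_mono divide_right_mono mult_left_mono) auto
      also have "\<kappa> * (1 / \<tau> N)\<^sup>2 = \<sigma> N / \<tau> N"
        unfolding \<sigma>_\<kappa> by (simp add: power2_eq_square)
      finally show ?thesis
        using V_ge[of N] by (simp add: power_mult_distrib algebra_simps)
    qed
    ultimately show "S N + \<kappa> * c\<^sup>2 / 2 * (real N * norm (xs - x N))\<^sup>2
        \<le> B * (P N)\<^sup>2 + \<Lambda> * (\<Sum>k=1..N. real k powr (- \<alpha>) * (real k * norm (xs - x k)))"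
      using telescope[of N] by (simp add: B_def distrib_right)
  next
    show "0 \<le> S N" for N
      unfolding S_def
    proof (rule sum_nonneg)
      fix k assume "k \<in> {1..N}"
      then obtain m where "k = Suc m"
        by (cases k) auto
      then show "0 \<le> \<sigma> (k - 1) * gap (x k) (y k)"
        using \<sigma>_pos[of m] gap_nonneg[OF x_dom y_dom] by simp
    qed
  qed (use \<kappa>(1) c(1) q CE CA V0 in \<open>auto simp: \<Lambda>_def B_def\<close>)

  \<comment> \<open>Passage to the ergodic means\<close>
  let ?X = "ergodic_mean \<sigma> x" and ?Y = "ergodic_mean \<sigma> y"
  have dom': "\<forall>n\<ge>1. x n \<in> edom g" "\<forall>n\<ge>1. y n \<in> edom hc"
    using x_dom y_dom by (metis Suc_le_D One_nat_def)+
  have "convex_on (edom g) (\<lambda>u. K u \<bullet> ys + F u + G u)"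
    by (intro convex_on_add conv(2) convex_on_subset[OF conv(1)] linear_imp_convex_on
        bounded_linear.linear bounded_linear_compose[OF bounded_linear_inner_left K]
        subset_UNIV convex_on_imp_convex[OF conv(2)])
  note X = ergodic_mean_convex[where \<sigma> = \<sigma> and z = x, OF this dom'(1) \<sigma>_pos]
  have "convex_on (edom hc) (\<lambda>w. - (K xs \<bullet> w) + H w)"
    by (intro convex_on_add conv(3) linear_imp_convex_on bounded_linear.linear
        bounded_linear_minus bounded_linear_inner_right convex_on_imp_convex[OF conv(3)])
  note Y = ergodic_mean_convex[where \<sigma> = \<sigma> and z = y, OF this dom'(2) \<sigma>_pos]
  have gap_le: "gap (?X N) (?Y N) \<le> 2 * C / (\<kappa> * c) * (P N)\<^sup>2 / (real N)\<^sup>2" if N: "N \<ge> 1" for N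
  proof -
    let ?W = "weight_sum \<sigma> N" and ?w = "\<lambda>k. \<sigma> (k - 1) / \<sigma> 0"
    let ?const = "- H ys - F xs - G xs"
    have W: "?W > 0"
      unfolding weight_sum_def using N \<sigma>_pos by (intro sum_pos) auto
    \<comment> \<open>The gap separates into a convex function of \<open>u\<close>, a convex
      function of \<open>w\<close> and a constant, so Jensen's inequality applies to each variable
      on its own.\<close>
    have split: "gap u w = (K u \<bullet> ys + F u + G u) + (- (K xs \<bullet> w) + H w) + ?const" for u w
      by (simp add: gap_def)
    have "gap (?X N) (?Y N) \<le> (\<Sum>k=1..N. ?w k * (K (x k) \<bullet> ys + F (x k) + G (x k))) / ?W
        + (\<Sum>k=1..N. ?w k * (- (K xs \<bullet> y k) + H (y k))) / ?W + ?W * ?const / ?W"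
      unfolding split using W by (intro add_mono X(2)[OF N] Y(2)[OF N]) simp
    also have "\<dots> = (\<Sum>k=1..N. ?w k * gap (x k) (y k)) / ?W"
      unfolding split distrib_left sum.distrib add_divide_distrib
      by (simp only: weight_sum_def sum_distrib_right)
    also have "\<dots> = S N / (\<sigma> 0 * ?W)"
      unfolding S_def by (simp flip: sum_divide_distrib)
    \<comment> \<open>Linearly growing weights have a sum of quadratic order, which is the source of
      the factor \<open>1 / (real N)\<^sup>2\<close>.\<close>
    also have "\<dots> \<le> C * (P N)\<^sup>2 / (\<kappa> * c * (real N)\<^sup>2 / 2)"
    proof (rule frac_le)
      have "\<sigma> (k - 1) \<ge> \<kappa> * (c * real k)" if "k \<ge> 1" for k
        unfolding \<sigma>_\<kappa> using c(2)[of "k - 1"] that \<kappa>(1) by (intro mult_left_mono) (auto simp: of_nat_diff)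
      then have "(\<Sum>k=1..N. \<kappa> * (c * real k)) \<le> (\<Sum>k=1..N. \<sigma> (k - 1))"
        by (intro sum_mono) auto
      also have "\<dots> = \<sigma> 0 * ?W"
        using \<sigma>_pos[of 0] by (simp add: weight_sum_def flip: sum_divide_distrib)
      also have "(\<Sum>k=1..N. \<kappa> * (c * real k)) = \<kappa> * c * (real N * (real N + 1) / 2)"
      proof -
        have "(\<Sum>k=1..N. real k) = real N * (real N + 1) / 2"
          by (induction N) (simp_all add: field_simps)
        then show ?thesis
          by (simp only: mult.assoc flip: sum_distrib_left)
      qed
      finally have "\<kappa> * c * (real N * (real N + 1) / 2) \<le> \<sigma> 0 * ?W" .
      moreover have "\<kappa> * c * ((real N)\<^sup>2 / 2) \<le> \<kappa> * c * (real N * (real N + 1) / 2)"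
        using \<kappa>(1) c(1) by (intro mult_left_mono) (auto simp: power2_eq_square distrib_left)
      ultimately show "\<kappa> * c * (real N)\<^sup>2 / 2 \<le> \<sigma> 0 * ?W"
        by simp
      show "0 < \<kappa> * c * (real N)\<^sup>2 / 2"
        using \<kappa>(1) c(1) N by simp
      show "S N \<le> C * (P N)\<^sup>2"
        by (rule S_le[OF N])
      show "0 \<le> C * (P N)\<^sup>2"
        using \<kappa>(1) c(1) q CE CA V0 by (simp add: C_def \<Lambda>_def B_def)
    qed
    also have "\<dots> = 2 * C / (\<kappa> * c) * (P N)\<^sup>2 / (real N)\<^sup>2"
      by simp
    finally show ?thesis .
  qed
  have eq: "lagrangian K f g h (?X N) ys - lagrangian K f g h xs (?Y N) = ereal (gap (?X N) (?Y N))"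
    if "N \<ge> 1" for N
    using lag_gap X(1)[OF that] Y(1)[OF that] .
  show ?thesis
    unfolding ereal_bigo_def
  proof
    show "\<forall>\<^sub>F N in sequentially.
        \<bar>lagrangian K f g h (?X N) ys - lagrangian K f g h xs (?Y N)\<bar> \<noteq> \<infinity>"
      using eventually_ge_at_top[of 1] by eventually_elim (simp add: eq)
    show "(\<lambda>N. real_of_ereal (lagrangian K f g h (?X N) ys - lagrangian K f g h xs (?Y N)))
        \<in> O(\<lambda>N. if \<alpha> > 1 then 1 / (real N)\<^sup>2
         else if \<alpha> = 1 then (ln (real N))\<^sup>2 / (real N)\<^sup>2
         else real N powr (- 2 * \<alpha>))"
    proof (rule power_sum_rate[OF \<alpha>])
      fix N :: nat assume N: "N \<ge> 1"
      \<comment> \<open>Nonnegativity, from the saddle point property, turns the upper bound into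
        one for the absolute value.\<close>
      have "0 \<le> gap (?X N) (?Y N)"
        by (rule gap_nonneg[OF X(1)[OF N] Y(1)[OF N]])
      then show "\<bar>real_of_ereal (lagrangian K f g h (?X N) ys - lagrangian K f g h xs (?Y N))\<bar>
          \<le> 2 * C / (\<kappa> * c) * (\<Sum>k=1..N. real k powr (- \<alpha>))\<^sup>2 / (real N)\<^sup>2"
        using gap_le[OF N] by (simp add: eq[OF N] P_def)
    qed
  qed
qed

end
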